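(* Let $d\ge3$, let $G$ be the Green kernel of $\mathbb{S}^d$, and let $\omega_N$ denote the first $N$ elements of a greedy $G$-energy sequence on $\mathbb{S}^d$. Then there exist positive constants $C_{G,1},C_{G,2}$ such that for all integers $N\ge2$ $$-C_{G,1}N^{2-2/d}\le E_G(\omega_N)\le -C_{G,2}N^{2-2/d}.$$
   Context: $\mathbb{S}^d$ is the unit sphere in $\mathbb{R}^{d+1}$ with its standard Riemannian metric, volume measure $\mathrm{vol}$, total volume $V$. The Green kernel $G(x,y)$ of $\mathbb{S}^d$ is symmetric, smooth off the diagonal (with value $+\infty$ on the diagonal), satisfies $\Delta G(x,\cdot)=\delta_x-V^{-1}\mathrm{vol}$ in the sense of distributions, where $\Delta=-\operatorname{div}\nabla$ is the Laplace–Beltrami operator, and is normalized by $\int_{\mathbb{S}^d}G(x,y)\,d\mathrm{vol}(y)=0$ for all $x$. For $\omega_N=\{x_1,\dots,x_N\}$, $E_G(\omega_N)=\sum_{i\ne j}G(x_i,x_j)$ (ordered pairs). A greedy $G$-energy sequence is obtained by taking an arbitrary $x_1\in\mathbb{S}^d$ and, for each $N\ge1$, choosing $x_{N+1}$ to be any minimizer of $x\mapsto\sum_{i=1}^N G(x,x_i)$ over $\mathbb{S}^d$. *)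

theory Defs
  imports "HOL-Analysis.Analysis"
begin

abbreviation unit_sphere :: "'a::euclidean_space set" where
  "unit_sphere \<equiv> sphere 0 1"

text \<open>
  The surface measure of the unit sphere, in the usual cone form coming from polar coordinates:
  the area of a Borel set \<open>A\<close> of the sphere is \<open>DIM('a)\<close> times the Lebesgue measure of
  \<open>{r *\<^sub>R a | r a. 0 < r \<and> r < 1 \<and> a \<in> A}\<close> (see \<open>emeasure_sphere_vol\<close> below).  This is the volume
  measure of the round metric; it is not normalised to a probability measure.
\<close>

definition sphere_vol :: "'a::euclidean_space measure" where
  "sphere_vol =
     scale_measure (of_nat DIM('a))
       (distr (restrict_space lborel (ball 0 1 - {0})) (restrict_space borel unit_sphere)
              (\<lambda>x. x /\<^sub>R norm x))"

lemma space_sphere_vol [simp]: "space sphere_vol = unit_sphere"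
  by (simp add: sphere_vol_def space_scale_measure space_restrict_space)

lemma sets_sphere_vol [measurable_cong]:
  "sets sphere_vol = sets (restrict_space borel unit_sphere)"
  by (simp add: sphere_vol_def)

lemma measurable_radial_projection:
  "(\<lambda>x::'a::euclidean_space. x /\<^sub>R norm x)
     \<in> restrict_space lborel (ball 0 1 - {0}) \<rightarrow>\<^sub>M restrict_space borel unit_sphere"
  by (rule measurable_restrict_space2)
     (auto simp: space_restrict_space intro!: measurable_restrict_space1)

lemma emeasure_sphere_vol:
  fixes A :: "'a::euclidean_space set"
  assumes A: "A \<in> sets borel" "A \<subseteq> unit_sphere"
  shows "emeasure sphere_vol A
           = of_nat DIM('a) * emeasure lborel {r *\<^sub>R a | r a. 0 < r \<and> r < 1 \<and> a \<in> A}"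
proof -
  let ?D = "ball 0 1 - {0} :: 'a set" and ?p = "\<lambda>x::'a. x /\<^sub>R norm x"
  have A': "A \<in> sets (restrict_space borel unit_sphere)"
    using A by (auto simp: sets_restrict_space)
  have eq: "?p -` A \<inter> ?D = {r *\<^sub>R a | r a. 0 < r \<and> r < 1 \<and> a \<in> A}"
  proof (intro equalityI subsetI)
    fix x assume "x \<in> ?p -` A \<inter> ?D"
    then have "x = norm x *\<^sub>R ?p x \<and> 0 < norm x \<and> norm x < 1 \<and> ?p x \<in> A"
      by auto
    then show "x \<in> {r *\<^sub>R a | r a. 0 < r \<and> r < 1 \<and> a \<in> A}"
      by blast
  next
    fix x assume "x \<in> {r *\<^sub>R a | r a. 0 < r \<and> r < 1 \<and> a \<in> A}"
    then obtain r a where x: "x = r *\<^sub>R a" "0 < r" "r < 1" "a \<in> A"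
      by blast
    moreover have "norm a = 1"
      using x(4) A(2) by auto
    ultimately show "x \<in> ?p -` A \<inter> ?D"
      by auto
  qed
  have "emeasure (distr (restrict_space lborel ?D) (restrict_space borel unit_sphere) ?p) A
          = emeasure (restrict_space lborel ?D) (?p -` A \<inter> ?D)"
    using emeasure_distr[OF measurable_radial_projection A'] by (simp add: space_restrict_space)
  also have "\<dots> = emeasure lborel (?p -` A \<inter> ?D)"
    by (rule emeasure_restrict_space) auto
  finally show ?thesis
    by (simp add: sphere_vol_def eq)
qed

text \<open>
  Gradient and divergence on the sphere as an embedded Riemannian submanifold.  A derivative
  within the sphere at \<open>x\<close> is determined only on the tangent space \<open>{v. v \<bullet> x = 0}\<close>.  The gradient is
  the tangent vector representing it.  The divergence of a tangent field \<open>X\<close> is the trace, over the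
  tangent space, of \<open>v \<mapsto> \<nabla>\<^sub>v X\<close>, where the Levi-Civita derivative \<open>\<nabla>\<^sub>v X\<close> is the tangential part of
  the ordinary derivative of \<open>X\<close> along \<open>v\<close>; extending that derivative by \<open>0\<close> in the normal direction
  \<open>x\<close> turns this into the sum over any orthonormal basis of the ambient space.
\<close>

definition sphere_grad :: "('a::euclidean_space \<Rightarrow> real) \<Rightarrow> 'a \<Rightarrow> 'a" where
  "sphere_grad f x =
     (THE g. g \<bullet> x = 0 \<and> (f has_derivative (\<lambda>v. g \<bullet> v)) (at x within unit_sphere))"

definition sphere_div :: "('a::euclidean_space \<Rightarrow> 'a) \<Rightarrow> 'a \<Rightarrow> real" where
  "sphere_div X x =
     (let D = (THE D. D x = 0 \<and> (X has_derivative D) (at x within unit_sphere))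
      in \<Sum>b\<in>Basis. D b \<bullet> b)"

definition sphere_laplacian :: "('a::euclidean_space \<Rightarrow> real) \<Rightarrow> 'a \<Rightarrow> real" where
  "sphere_laplacian f x = - sphere_div (sphere_grad f) x"

primrec Ck_on :: "nat \<Rightarrow> ('a::euclidean_space \<Rightarrow> real) \<Rightarrow> 'a set \<Rightarrow> bool" where
  "Ck_on 0 f U \<longleftrightarrow> continuous_on U f"
| "Ck_on (Suc k) f U \<longleftrightarrow>
     (\<forall>x\<in>U. f differentiable (at x)) \<and> (\<forall>v. Ck_on k (\<lambda>x. frechet_derivative f (at x) v) U)"

text \<open>Smoothness on an arbitrary subset of Euclidean space: local extendability to a
  \<open>C\<^sup>\<infinity>\<close> function on an open set.\<close>

definition smooth_on :: "'a::euclidean_space set \<Rightarrow> ('a \<Rightarrow> real) \<Rightarrow> bool" where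
  "smooth_on A f \<longleftrightarrow>
     (\<forall>x\<in>A. \<exists>U F. open U \<and> x \<in> U \<and> (\<forall>k. Ck_on k F U) \<and> (\<forall>y\<in>U \<inter> A. F y = f y))"

text \<open>
  \<open>G\<close> is the Green kernel of the sphere (only its values on pairs of points of the sphere matter).
  The distributional equation is tested against smooth functions \<open>\<phi>\<close>, the Laplacian being moved to
  \<open>\<phi>\<close>.  The value \<open>\<infinity>\<close> on the diagonal becomes \<open>0\<close> under \<open>real_of_ereal\<close>, which the integrals
  do not see, as it affects a single point.
\<close>

definition green_kernel :: "('a::euclidean_space \<Rightarrow> 'a \<Rightarrow> ereal) \<Rightarrow> bool" where
  "green_kernel G \<longleftrightarrow>
     (\<forall>x\<in>unit_sphere. \<forall>y\<in>unit_sphere. G x y = G y x) \<and>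
     (\<forall>x\<in>unit_sphere. G x x = \<infinity>) \<and>
     (\<forall>x\<in>unit_sphere. \<forall>y\<in>unit_sphere. x \<noteq> y \<longrightarrow> \<bar>G x y\<bar> \<noteq> \<infinity>) \<and>
     smooth_on {(x, y). x \<in> unit_sphere \<and> y \<in> unit_sphere \<and> x \<noteq> y}
       (\<lambda>(x, y). real_of_ereal (G x y)) \<and>
     (\<forall>x\<in>unit_sphere. integrable sphere_vol (\<lambda>y. real_of_ereal (G x y))) \<and>
     (\<forall>x\<in>unit_sphere. \<forall>\<phi>. smooth_on unit_sphere \<phi> \<longrightarrow>
        (LINT y|sphere_vol. real_of_ereal (G x y) * sphere_laplacian \<phi> y)
          = \<phi> x - (LINT y|sphere_vol. \<phi> y) / measure sphere_vol (unit_sphere :: 'a set)) \<and>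
     (\<forall>x\<in>unit_sphere. (LINT y|sphere_vol. real_of_ereal (G x y)) = 0)"

text \<open>Sequences are indexed from \<open>1\<close>; the term with index \<open>0\<close> is irrelevant.\<close>

definition energy :: "('a \<Rightarrow> 'a \<Rightarrow> ereal) \<Rightarrow> (nat \<Rightarrow> 'a) \<Rightarrow> nat \<Rightarrow> ereal" where
  "energy G x N = (\<Sum>i\<in>{1..N}. \<Sum>j\<in>{1..N} - {i}. G (x i) (x j))"

definition greedy_sequence ::
    "('a::euclidean_space \<Rightarrow> 'a \<Rightarrow> ereal) \<Rightarrow> (nat \<Rightarrow> 'a) \<Rightarrow> bool" where
  "greedy_sequence G x \<longleftrightarrow>
     x 1 \<in> unit_sphere \<and>
     (\<forall>N\<ge>1. is_arg_min (\<lambda>y. \<Sum>i\<in>{1..N}. G y (x i)) (\<lambda>y. y \<in> unit_sphere) (x (N + 1)))"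

end

theory Submission
  imports Defs "HOL-Real_Asymp.Real_Asymp"
begin

text \<open>
  Write \<open>z = (1 + x \<bullet> y) / 2\<close>, let \<open>\<mu> n\<close> be the mean of \<open>z ^ n\<close> over the sphere and \<open>V\<close> the total
  volume.  Since \<open>\<Delta> (z ^ n) = n (n + d - 1) z ^ n - n (n - 1 + d/2) z ^ (n - 1)\<close>, testing the Green
  kernel with \<open>z ^ n\<close> gives a recursion in \<open>n\<close> for its integral against \<open>z ^ n / \<mu> n\<close>, and these
  densities concentrate at a point.  In the limit
  \<open>V G(x, y) = \<Sum>k\<ge>1. (z ^ k / \<mu> k - 1) / (k (k + d - 1))\<close>.

  Lower bound, for any distinct points: truncating this series after \<open>m\<close> terms costs at most \<open>1/m\<close>
  per pair.  The kernels \<open>z ^ k - \<mu> k\<close> are positive semidefinite, so only the diagonal, of order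
  \<open>m powr (d/2 - 1)\<close> per point, counts against the truncated energy; take \<open>m \<approx> N powr (2/d)\<close>.

  Upper bound: a potential \<open>U\<close> of \<open>N\<close> points has mean zero, so its \<open>L\<^sup>1\<close> norm is at most \<open>2 V |min U|\<close>.
  Integrating \<open>U\<close> against \<open>\<Delta> (z ^ n)\<close> centred at \<open>p\<close> gives \<open>\<Sum>i. z(x i, p) ^ n - N \<mu> n\<close>.  For \<open>n\<close> a
  large multiple of \<open>N powr (2/d)\<close> the \<open>N\<close> bumps are too narrow to fill the sphere, so the \<open>L\<^sup>1\<close> norm
  in \<open>p\<close> of this difference is at least \<open>N \<mu> n V\<close>, whereas \<open>\<Delta> (z ^ n)\<close> has \<open>L\<^sup>1\<close> norm of order
  \<open>n \<mu> n\<close>.  Hence \<open>min U \<le> - c N / n\<close>, of order \<open>N powr (1 - 2/d)\<close>, and a greedy step adds \<open>2 min U\<close>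
  to the energy.
\<close>

section \<open>The Laplacian of ridge functions\<close>

lemma tangent_derivative_within_sphere:
  fixes f :: "'a::euclidean_space \<Rightarrow> 'b::real_normed_vector"
  assumes f: "(f has_derivative D) (at x within unit_sphere)"
    and x: "norm x = 1" and w: "norm w = 1" "w \<bullet> x = 0"
  shows "((\<lambda>s. f (cos s *\<^sub>R x + sin s *\<^sub>R w)) has_vector_derivative D w) (at 0)"
proof -
  let ?c = "\<lambda>s. cos s *\<^sub>R x + sin s *\<^sub>R w"
  have c: "(?c has_derivative (\<lambda>h. h *\<^sub>R w)) (at 0)"
    by (auto intro!: derivative_eq_intros)
  have on: "norm (?c s) = 1" for s
  proof -
    have "(norm (?c s))\<^sup>2 = (cos s)\<^sup>2 * (norm x)\<^sup>2 + (sin s)\<^sup>2 * (norm w)\<^sup>2"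
      using w(2) unfolding power2_norm_eq_inner
      by (simp add: inner_simps inner_commute power2_eq_square)
    then show ?thesis
      using x w(1) by (simp add: power2_eq_1_iff) (smt (verit) norm_ge_zero)
  qed
  \<comment> \<open>The great circle \<open>?c\<close> stays on the sphere and passes through
    \<open>x\<close> in both directions, so the restricted derivative becomes an ordinary two-sided
    one in \<open>s\<close>.\<close>
  have "(f has_derivative D) (at (?c 0) within range ?c)"
    using on by (auto intro!: has_derivative_subset[OF f])
  from has_derivative_in_compose[OF c this]
  have "((\<lambda>s. f (?c s)) has_derivative (\<lambda>h. D (h *\<^sub>R w))) (at 0)" by simp
  moreover have "D (h *\<^sub>R w) = h *\<^sub>R D w" for h
    using f by (simp add: has_derivative_def bounded_linear_def linear.scaleR)
  ultimately show ?thesis by (simp add: has_vector_derivative_def)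
qed

text \<open>Every tangent vector is a multiple of the velocity of a great circle, along which
  \<open>f\<close> has an ordinary and hence unique derivative. In the normal direction
  \<open>D\<close> and \<open>E\<close> may differ.\<close>

lemma derivative_within_sphere_unique:
  fixes f :: "'a::euclidean_space \<Rightarrow> 'b::real_normed_vector"
  assumes D: "(f has_derivative D) (at x within unit_sphere)"
    and E: "(f has_derivative E) (at x within unit_sphere)"
    and x: "norm x = 1" and v: "v \<bullet> x = 0"
  shows "D v = E v"
proof (cases "v = 0")
  case True
  then show ?thesis
    using D E by (auto simp: has_derivative_def bounded_linear_def linear_0)
next
  case False
  define w where "w = v /\<^sub>R norm v"
  have w: "norm w = 1" "w \<bullet> x = 0" and vw: "v = norm v *\<^sub>R w"
    using False v by (auto simp: w_def)
  have "D w = E w"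
    using tangent_derivative_within_sphere[OF D x w] tangent_derivative_within_sphere[OF E x w]
    by (rule vector_derivative_unique_at)
  moreover have "D v = norm v *\<^sub>R D w" "E v = norm v *\<^sub>R E w"
    using D E by (subst vw; simp add: has_derivative_def bounded_linear_def linear.scaleR)+
  ultimately show ?thesis by simp
qed

text \<open>On the sphere, \<open>f\<close> agrees with its composition with the radial projection, whose derivative
  at \<open>x\<close> is the orthogonal projection onto the tangent space.\<close>

lemma has_derivative_within_sphere_tangential:
  fixes f :: "'a::euclidean_space \<Rightarrow> 'b::real_normed_vector"
  assumes f: "(f has_derivative D) (at x within unit_sphere)" and x: "norm x = 1"
  shows "(f has_derivative (\<lambda>v. D (v - (v \<bullet> x) *\<^sub>R x))) (at x within unit_sphere)"
proof -
  let ?p = "\<lambda>y::'a. inverse (norm y) *\<^sub>R y"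
  have "x \<noteq> 0" using x by auto
  have n: "(norm has_derivative (\<lambda>v. v \<bullet> x)) (at x within unit_sphere)"
    using has_derivative_norm[of x] x \<open>x \<noteq> 0\<close>
    by (simp add: sgn_div_norm inner_commute has_derivative_at_withinI)
  have p: "(?p has_derivative (\<lambda>v. v - (v \<bullet> x) *\<^sub>R x)) (at x within unit_sphere)"
    by (rule derivative_eq_intros n | use x \<open>x \<noteq> 0\<close> in force)+
  have "(f has_derivative D) (at (?p x) within ?p ` unit_sphere)"
    using x by (auto intro!: has_derivative_subset[OF f])
  from has_derivative_in_compose[OF p this]
  show ?thesis
    by (rule has_derivative_transform[rotated 2]) (auto simp: x)
qed

text \<open>Evaluates the definite description from any derivative \<open>D\<close>. Existence comes
  from precomposing \<open>D\<close> with the tangential projection; for uniqueness, the difference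
  of two candidates is tangent and orthogonal to itself.\<close>

lemma sphere_grad_eqI:
  fixes f :: "'a::euclidean_space \<Rightarrow> real"
  assumes f: "(f has_derivative D) (at x within unit_sphere)" and x: "norm x = 1"
    and g: "g \<bullet> x = 0" "\<And>v. v \<bullet> x = 0 \<Longrightarrow> D v = g \<bullet> v"
  shows "sphere_grad f x = g"
  unfolding sphere_grad_def
proof (rule the_equality)
  have "D (v - (v \<bullet> x) *\<^sub>R x) = g \<bullet> v" for v
    using x g by (simp add: inner_simps norm_eq_1)
  then show "g \<bullet> x = 0 \<and> (f has_derivative (\<bullet>) g) (at x within unit_sphere)"
    using has_derivative_within_sphere_tangential[OF f x] g(1) by simp
next
  fix g' assume g': "g' \<bullet> x = 0 \<and> (f has_derivative (\<bullet>) g') (at x within unit_sphere)"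
  have "(g' - g) \<bullet> x = 0" using g g' by (simp add: inner_simps)
  moreover have "g' \<bullet> (g' - g) = D (g' - g)"
    using derivative_within_sphere_unique[of f "(\<bullet>) g'" x D] f x g' calculation by blast
  ultimately have "(g' - g) \<bullet> (g' - g) = 0"
    using g(2)[of "g' - g"] by (simp add: inner_simps inner_commute)
  then show "g' = g" by simp
qed

text \<open>A derivative \<open>D\<close> need not vanish on the normal \<open>x\<close>; composing
  it with the tangential projection removes exactly \<open>D x \<bullet> x\<close> from its
  trace.\<close>

lemma sphere_div_eqI:
  fixes X :: "'a::euclidean_space \<Rightarrow> 'a"
  assumes X: "(X has_derivative D) (at x within unit_sphere)" and x: "norm x = 1"
  shows "sphere_div X x = (\<Sum>b\<in>Basis. D b \<bullet> b) - D x \<bullet> x"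
proof -
  interpret D: bounded_linear D using X by (rule has_derivative_bounded_linear)
  let ?D = "\<lambda>v. D (v - (v \<bullet> x) *\<^sub>R x)"
  have "(THE D. D x = 0 \<and> (X has_derivative D) (at x within unit_sphere)) = ?D"
  proof (rule the_equality)
    show "?D x = 0 \<and> (X has_derivative ?D) (at x within unit_sphere)"
      using has_derivative_within_sphere_tangential[OF X x] x by (simp add: norm_eq_1)
  next
    fix E assume E: "E x = 0 \<and> (X has_derivative E) (at x within unit_sphere)"
    then interpret E: bounded_linear E using has_derivative_bounded_linear by blast
    show "E = ?D"
    proof
      fix v
      have "(v - (v \<bullet> x) *\<^sub>R x) \<bullet> x = 0" using x by (simp add: inner_simps norm_eq_1)
      from derivative_within_sphere_unique[OF _ X x this, of E] E
      show "E v = ?D v" by (simp add: E.diff E.scaleR)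
    qed
  qed
  then have "sphere_div X x = (\<Sum>b\<in>Basis. ?D b \<bullet> b)"
    by (simp add: sphere_div_def)
  also have "\<dots> = (\<Sum>b\<in>Basis. D b \<bullet> b) - (\<Sum>b\<in>Basis. (x \<bullet> b) * (D x \<bullet> b))"
    by (simp add: D.diff D.scaleR inner_simps sum_subtractf inner_commute)
  finally show ?thesis by (simp add: euclidean_inner[of "D x" x] mult.commute)
qed

text \<open>The gradient of \<open>p \<bullet> y\<close> is the tangential part of \<open>p\<close>,
  with squared length \<open>1 - (p \<bullet> y)\<^sup>2\<close> and divergence
  \<open>- (DIM('a) - 1) * (p \<bullet> y)\<close>; the formula is the product rule for
  \<open>f'\<close> times this field.\<close>

lemma sphere_laplacian_ridge:
  fixes p :: "'a::euclidean_space"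
  assumes p: "norm p = 1" and y: "norm y = 1"
    and f: "\<And>t. (f has_real_derivative f' t) (at t)"
    and f': "\<And>t. (f' has_real_derivative f'' t) (at t)"
  shows "sphere_laplacian (\<lambda>y. f (p \<bullet> y)) y
    = (real DIM('a) - 1) * (p \<bullet> y) * f' (p \<bullet> y) - (1 - (p \<bullet> y)\<^sup>2) * f'' (p \<bullet> y)"
proof -
  let ?X = "\<lambda>y. f' (p \<bullet> y) *\<^sub>R (p - (p \<bullet> y) *\<^sub>R y)"
  have inner: "((\<lambda>y. p \<bullet> y) has_derivative (\<lambda>v. p \<bullet> v)) (at x within A)" for x A
    by (auto intro!: derivative_eq_intros)
  have grad: "sphere_grad (\<lambda>y. f (p \<bullet> y)) x = ?X x" if x: "norm x = 1" for x
  proof (rule sphere_grad_eqI[OF _ x])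
    show "((\<lambda>y. f (p \<bullet> y)) has_derivative (\<lambda>v. f' (p \<bullet> x) * (p \<bullet> v))) (at x within unit_sphere)"
      using has_derivative_compose[OF inner f[unfolded has_field_derivative_def]] .
    show "?X x \<bullet> x = 0" using x by (simp add: inner_simps norm_eq_1)
    show "f' (p \<bullet> x) * (p \<bullet> v) = ?X x \<bullet> v" if "v \<bullet> x = 0" for v
      using that by (simp add: inner_simps inner_commute)
  qed
  define D where "D = (\<lambda>v. (f'' (p \<bullet> y) * (p \<bullet> v)) *\<^sub>R (p - (p \<bullet> y) *\<^sub>R y)
      - f' (p \<bullet> y) *\<^sub>R ((p \<bullet> v) *\<^sub>R y + (p \<bullet> y) *\<^sub>R v))"
  have f'p: "((\<lambda>y. f' (p \<bullet> y)) has_derivative (\<lambda>v. f'' (p \<bullet> y) * (p \<bullet> v))) (at y within unit_sphere)"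
    using has_derivative_compose[OF inner f'[unfolded has_field_derivative_def]] .
  have "(?X has_derivative D) (at y within unit_sphere)"
    unfolding D_def
    by (auto intro!: derivative_eq_intros f'p simp: fun_eq_iff algebra_simps)
  then have "(sphere_grad (\<lambda>y. f (p \<bullet> y)) has_derivative D) (at y within unit_sphere)"
    by (rule has_derivative_transform[rotated 2]) (use y grad in auto)
  from sphere_div_eqI[OF this y]
  have "sphere_laplacian (\<lambda>y. f (p \<bullet> y)) y = D y \<bullet> y - (\<Sum>b\<in>Basis. D b \<bullet> b)"
    by (simp add: sphere_laplacian_def)
  also have "D y \<bullet> y = - 2 * f' (p \<bullet> y) * (p \<bullet> y)"
    using y by (simp add: D_def inner_simps norm_eq_1)
  also have "(\<Sum>b\<in>Basis. D b \<bullet> b) = f'' (p \<bullet> y) * ((\<Sum>b\<in>Basis. (p \<bullet> b) * (p \<bullet> b)) - (p \<bullet> y) * (\<Sum>b\<in>Basis. (p \<bullet> b) * (y \<bullet> b)))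
     - f' (p \<bullet> y) * ((\<Sum>b\<in>Basis. (p \<bullet> b) * (y \<bullet> b)) + (p \<bullet> y) * (\<Sum>b\<in>(Basis::'a set). b \<bullet> b))"
    unfolding D_def
    by (simp add: inner_simps sum_subtractf sum.distrib sum_distrib_left algebra_simps)
  also have "\<dots> = f'' (p \<bullet> y) * (1 - (p \<bullet> y)\<^sup>2) - f' (p \<bullet> y) * ((p \<bullet> y) + (p \<bullet> y) * DIM('a))"
    using p by (simp add: euclidean_inner[symmetric] norm_eq_1 power2_eq_square)
  finally show ?thesis by (simp add: algebra_simps)
qed

text \<open>A directional derivative only lowers the exponent and changes the constant, so the
  family with free \<open>c\<close> and \<open>n\<close> is closed under differentiation. At
  \<open>n = 0\<close> the factor \<open>n\<close> kills the term with the truncated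
  exponent.\<close>

lemma Ck_on_ridge_power:
  fixes p :: "'a::euclidean_space"
  shows "Ck_on k (\<lambda>y. c * ((1 + p \<bullet> y) / 2) ^ n) U"
proof (induction k arbitrary: c n)
  case 0
  show ?case by (auto intro!: continuous_intros)
next
  case (Suc k)
  have D: "((\<lambda>y. c * ((1 + p \<bullet> y) / 2) ^ n) has_derivative
      (\<lambda>v. c * n * ((1 + p \<bullet> y) / 2) ^ (n - 1) * (p \<bullet> v) / 2)) (at y)" for y
    by (auto intro!: derivative_eq_intros simp: fun_eq_iff)
  have "(\<lambda>y. frechet_derivative (\<lambda>y. c * ((1 + p \<bullet> y) / 2) ^ n) (at y) v)
     = (\<lambda>y. (c * n * (p \<bullet> v) / 2) * ((1 + p \<bullet> y) / 2) ^ (n - 1))" for v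
    by (auto simp: frechet_derivative_at[OF D, symmetric])
  then show ?case using D Suc[of "c * n * (p \<bullet> v) / 2" "n - 1" for v] unfolding Ck_on.simps
    by (simp only: differentiable_def) blast
qed

lemma smooth_on_ridge_power:
  "smooth_on A (\<lambda>y. ((1 + p \<bullet> y) / 2) ^ n)"
  using Ck_on_ridge_power[of _ 1 p n] unfolding smooth_on_def
  by (auto intro!: exI[of _ UNIV] exI[of _ "\<lambda>y. ((1 + p \<bullet> y) / 2) ^ n"])

text \<open>Since \<open>1 - (p \<bullet> y)\<^sup>2 = 4 * z * (1 - z)\<close>, only two consecutive
  powers of \<open>z\<close> survive; this makes the Green equation a two-term recursion.\<close>

lemma sphere_laplacian_ridge_power:
  fixes p :: "'a::euclidean_space"
  assumes p: "norm p = 1" and y: "norm y = 1" and d: "d = real DIM('a) - 1"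
  defines "z \<equiv> (1 + p \<bullet> y) / 2"
  shows "sphere_laplacian (\<lambda>y. ((1 + p \<bullet> y) / 2) ^ n) y
     = real n * (real n + d - 1) * z ^ n - real n * (real n - 1 + d / 2) * z ^ (n - 1)"
proof -
  have "sphere_laplacian (\<lambda>y. (\<lambda>t. ((1 + t) / 2) ^ n) (p \<bullet> y)) y
    = (real DIM('a) - 1) * (p \<bullet> y) * (n / 2 * z ^ (n - 1)) - (1 - (p \<bullet> y)\<^sup>2) * (n / 2 * (real (n - 1) / 2 * z ^ (n - 2)))"
    unfolding z_def
    by (rule sphere_laplacian_ridge[OF p y])
      (auto intro!: derivative_eq_intros simp: numeral_2_eq_2)
  also have "p \<bullet> y = 2 * z - 1" by (simp add: z_def field_simps)
  also have "(1 - (2 * z - 1)\<^sup>2) = 4 * z * (1 - z)" by (simp add: power2_eq_square algebra_simps)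
  \<comment> \<open>The exponents \<open>n - 1\<close> and \<open>n - 2\<close> are truncated, so
    \<open>n = 0\<close>, \<open>n = 1\<close> and larger \<open>n\<close> are checked
    separately.\<close>
  finally show ?thesis
    unfolding d[symmetric]
    by (cases n rule: nat.exhaust; cases "n - 1") (auto simp: field_simps)
qed

section \<open>Moments of the surface measure\<close>

lemma sphere_vol_eq_density:
  "sphere_vol = density (distr (restrict_space lborel (ball 0 1 - {0})) (restrict_space borel unit_sphere)
     (\<lambda>x::'a::euclidean_space. x /\<^sub>R norm x)) (\<lambda>_. ennreal (real DIM('a)))"
  unfolding sphere_vol_def
  by (rule measure_eqI) (auto simp: emeasure_density nn_integral_cmult_indicator ennreal_of_nat_eq_real_of_nat)

lemma measurable_sphere_vol_borel:
  assumes "f \<in> borel_measurable borel"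
  shows "f \<in> borel_measurable sphere_vol"
proof -
  have "f \<in> borel_measurable (restrict_space borel unit_sphere)"
    using assms by (rule measurable_restrict_space1)
  then show ?thesis by (simp cong: measurable_cong_sets add: measurable_cong_sets[OF sets_sphere_vol refl])
qed

lemma integral_sphere_vol:
  fixes f :: "'a::euclidean_space \<Rightarrow> real"
  assumes f: "f \<in> borel_measurable borel"
  shows "(LINT y|sphere_vol. f y) = DIM('a) * (LINT z:ball 0 1|lborel. f (z /\<^sub>R norm z))"
proof -
  let ?B = "ball 0 1 - {0} :: 'a set"
  have fr: "f \<in> borel_measurable (restrict_space borel unit_sphere)"
    using f by (rule measurable_restrict_space1)
  have "(LINT y|sphere_vol. f y) = DIM('a) * (LINT y|(distr (restrict_space lborel ?B) (restrict_space borel unit_sphere)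
     (\<lambda>x::'a. x /\<^sub>R norm x)). f y)"
    unfolding sphere_vol_eq_density using fr
    by (subst integral_density) (auto)
  also have "\<dots> = DIM('a) * (LINT z|restrict_space lborel ?B. f (z /\<^sub>R norm z))"
    using fr by (subst integral_distr[OF measurable_radial_projection]) auto
  also have "(LINT z|restrict_space lborel ?B. f (z /\<^sub>R norm z)) = (LINT z:?B|lborel. f (z /\<^sub>R norm z))"
    by (subst integral_restrict_space) (auto simp: set_lebesgue_integral_def)
  also have "\<dots> = (LINT z:ball 0 1|lborel. f (z /\<^sub>R norm z))"
    unfolding set_lebesgue_integral_def
  proof (rule integral_cong_AE)
    show "AE z in lborel. indicat_real ?B z *\<^sub>R f (z /\<^sub>R norm z) = indicat_real (ball 0 1) z *\<^sub>R f (z /\<^sub>R norm z)"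
      using AE_lborel_singleton[of 0] by eventually_elim (auto simp: indicator_def)
  qed (auto intro!: borel_measurable_times borel_measurable_indicator measurable_compose[OF _ f])
  finally show ?thesis .
qed

lemma emeasure_sphere_vol_finite: "emeasure sphere_vol (unit_sphere :: 'a::euclidean_space set) < \<infinity>"
proof -
  have "{r *\<^sub>R a | r a. 0 < r \<and> r < 1 \<and> a \<in> unit_sphere} \<subseteq> (ball 0 1 :: 'a set)" by auto
  then have "emeasure lborel {r *\<^sub>R a | r a. 0 < r \<and> r < 1 \<and> (a::'a) \<in> unit_sphere} \<le> emeasure lborel (ball 0 1 :: 'a set)"
    by (intro emeasure_mono) auto
  also have "\<dots> < \<infinity>" using emeasure_lborel_ball_finite by auto
  finally show ?thesis
    by (simp add: emeasure_sphere_vol ennreal_mult_less_top of_nat_less_top)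
qed

lemma finite_measure_sphere_vol: "finite_measure (sphere_vol :: 'a::euclidean_space measure)"
  using emeasure_sphere_vol_finite[where 'a='a] by (intro finite_measureI) (simp add: less_top)

text \<open>Substituting \<open>r *\<^sub>R z\<close> for \<open>z\<close> produces the Jacobian
  \<open>r ^ DIM('a)\<close> and a factor \<open>r ^ k\<close>, while \<open>H\<close> is constant
  along rays.\<close>

lemma integral_norm_power_ball_scale:
  fixes H :: "'a::euclidean_space \<Rightarrow> real"
  assumes H[measurable]: "H \<in> borel_measurable borel" and hom: "\<And>r z. r > 0 \<Longrightarrow> H (r *\<^sub>R z) = H z"
    and r: "r > 0"
  shows "(LINT z:ball 0 r|lborel. norm z ^ k * H z) = r ^ (k + DIM('a)) * (LINT z:ball 0 1|lborel. norm z ^ k * H z)"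
proof -
  have [measurable]: "(\<lambda>z. indicat_real (ball 0 r) z * (norm z ^ k * H z)) \<in> borel_measurable borel"
    by (intro borel_measurable_times borel_measurable_indicator borel_measurable_power) auto
  have ind: "indicat_real (ball 0 r) (r *\<^sub>R z) = indicat_real (ball 0 1) z" for z :: 'a
    using r by (auto simp: indicator_def)
  have "(LINT z:ball 0 r|lborel. norm z ^ k * H z)
    = (LINT z|density (distr lborel borel (\<lambda>z. 0 + r *\<^sub>R z)) (\<lambda>_. \<bar>r\<bar> ^ DIM('a)). indicat_real (ball 0 r) z * (norm z ^ k * H z))"
    unfolding set_lebesgue_integral_def using r by (subst lborel_affine[of r 0]) auto
  also have "\<dots> = (LINT z|lborel. r ^ DIM('a) * (indicat_real (ball 0 r) (r *\<^sub>R z) * (norm (r *\<^sub>R z) ^ k * H (r *\<^sub>R z))))"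
    using r by (subst integral_density) (auto simp: integral_distr simp del: norm_scaleR)
  also have "\<dots> = (LINT z|lborel. r ^ (k + DIM('a)) * (indicat_real (ball 0 1) z * (norm z ^ k * H z)))"
    by (rule Bochner_Integration.integral_cong) (use r in \<open>auto simp: ind hom power_add power_mult_distrib\<close>)
  also have "\<dots> = r ^ (k + DIM('a)) * (LINT z:ball 0 1|lborel. norm z ^ k * H z)"
    by (simp add: set_lebesgue_integral_def)
  finally show ?thesis .
qed

lemma set_integrable_norm_power:
  fixes H :: "'a::euclidean_space \<Rightarrow> real"
  assumes H[measurable]: "H \<in> borel_measurable borel" and "\<And>z. \<bar>H z\<bar> \<le> C"
    and A[measurable]: "A \<in> sets borel" "A \<subseteq> ball 0 1"
  shows "set_integrable lborel A (\<lambda>z. norm z ^ k * H z)"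
proof -
  have "set_integrable lborel (ball 0 1) (\<lambda>z. norm z ^ k * H z)"
    unfolding set_integrable_def
  proof (rule Bochner_Integration.integrable_bound)
    show "integrable lborel (\<lambda>z::'a. indicat_real (ball 0 1) z * C)"
      using emeasure_lborel_ball_finite by (intro integrable_mult_left integrable_real_indicator) auto
    have "norm z ^ k * \<bar>H z\<bar> \<le> 1 * \<bar>C\<bar>" if "norm z < 1" for z
      using assms(2)[of z] that by (intro mult_mono power_le_one) auto
    then show "AE z in lborel. norm (indicat_real (ball 0 1) z *\<^sub>R (norm z ^ k * H z))
        \<le> norm (indicat_real (ball 0 1) z * C)"
      by (auto simp: abs_mult indicator_def)
    show "(\<lambda>z. indicat_real (ball 0 1) z *\<^sub>R (norm z ^ k * H z)) \<in> borel_measurable lborel"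
      by (intro borel_measurable_scaleR borel_measurable_times borel_measurable_indicator borel_measurable_power) auto
  qed
  then show ?thesis by (rule set_integrable_subset) (use assms in auto)
qed

text \<open>The integral over the thin shell \<open>r \<le> norm z < 1\<close> is known exactly by scaling, and on that shell
  \<open>norm z ^ k\<close> lies between \<open>r ^ k\<close> and \<open>1\<close>; let \<open>r \<rightarrow> 1\<close>.\<close>

lemma integral_norm_power_ball_nonneg:
  fixes H :: "'a::euclidean_space \<Rightarrow> real"
  assumes H[measurable]: "H \<in> borel_measurable borel" and hom: "\<And>r z. r > 0 \<Longrightarrow> H (r *\<^sub>R z) = H z"
    and bd: "\<And>z. \<bar>H z\<bar> \<le> C" and nn: "\<And>z. H z \<ge> 0"
  shows "(k + DIM('a)) * (LINT z:ball 0 1|lborel. norm z ^ k * H z) = DIM('a) * (LINT z:ball 0 1|lborel. H z)"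
proof -
  define A where "A = (\<lambda>k. LINT z:ball 0 1|lborel. norm z ^ k * H z)"
  note int = set_integrable_norm_power[OF H bd]
  note int0 = int[of _ 0, simplified]
  have annulus: "(LINT z:ball 0 1 - ball 0 r|lborel. norm z ^ k * H z) = (1 - r ^ (k + DIM('a))) * A k"
    if r: "0 < r" "r < 1" for r k
  proof -
    have "(LINT z:ball 0 1|lborel. norm z ^ k * H z) = (LINT z:(ball 0 1 - ball 0 r) \<union> ball 0 r|lborel. norm z ^ k * H z)"
      using r by (intro arg_cong[where f="\<lambda>A. set_lebesgue_integral lborel A _"]) auto
    also have "\<dots> = (LINT z:ball 0 1 - ball 0 r|lborel. norm z ^ k * H z) + (LINT z:ball 0 r|lborel. norm z ^ k * H z)"
      by (rule set_integral_Un) (use r in \<open>auto intro!: int\<close>)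
    finally show ?thesis
      using integral_norm_power_ball_scale[OF H hom r(1), of k] by (simp add: A_def left_diff_distrib)
  qed
  have upper: "(1 - r ^ (k + DIM('a))) * A k \<le> (1 - r ^ DIM('a)) * A 0" if r: "0 < r" "r < 1" for r
  proof -
    have "(LINT z:ball 0 1 - ball 0 r|lborel. norm z ^ k * H z) \<le> (LINT z:ball 0 1 - ball 0 r|lborel. norm z ^ 0 * H z)"
      by (rule set_integral_mono) (use nn in \<open>auto intro!: int int0 mult_left_le_one_le power_le_one\<close>)
    then show ?thesis using annulus[OF r, of k] annulus[OF r, of 0] by simp
  qed
  have lower: "r ^ k * ((1 - r ^ DIM('a)) * A 0) \<le> (1 - r ^ (k + DIM('a))) * A k" if r: "0 < r" "r < 1" for r
  proof -
    have "(LINT z:ball 0 1 - ball 0 r|lborel. r ^ k * (norm z ^ 0 * H z)) \<le> (LINT z:ball 0 1 - ball 0 r|lborel. norm z ^ k * H z)"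
      by (rule set_integral_mono) (use nn r in \<open>auto intro!: int int0 mult_right_mono power_mono set_integrable_mult_right int[of _ 0, simplified]\<close>)
    then show ?thesis using annulus[OF r, of k] annulus[OF r, of 0] by simp
  qed
  \<comment> \<open>Dividing the shell estimates by \<open>1 - r\<close> turns each factor
    \<open>1 - r ^ n\<close> into the derivative of \<open>r ^ n\<close> at \<open>1\<close>, that
    is \<open>n\<close>.\<close>
  have lim: "((\<lambda>r. (1 - r ^ n) / (1 - r)) \<longlongrightarrow> real n) (at_left 1)" for n :: nat
  proof -
    have "((\<lambda>r::real. r ^ n) has_real_derivative n) (at 1 within {..<1})"
      by (auto intro!: derivative_eq_intros)
    then have "((\<lambda>r. (r ^ n - 1) / (r - 1)) \<longlongrightarrow> real n) (at_left 1)"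
      by (simp add: has_field_derivative_iff)
    then show ?thesis
      by (rule Lim_transform_eventually) (auto simp: eventually_at_filter divide_simps algebra_simps)
  qed
  have pos: "\<forall>\<^sub>F r in at_left 1. 0 < r \<and> r < (1::real)"
    by (metis (no_types, lifting) eventually_at_left_field greaterThanLessThan_iff zero_less_one)
  have "(k + DIM('a)) * A k \<le> DIM('a) * A 0"
  proof (rule tendsto_le[OF _ tendsto_mult[OF lim tendsto_const] tendsto_mult[OF lim tendsto_const]])
    show "\<forall>\<^sub>F r in at_left 1. (1 - r ^ (k + DIM('a))) / (1 - r) * A k \<le> (1 - r ^ DIM('a)) / (1 - r) * A 0"
      using pos by eventually_elim (use upper in \<open>auto simp: divide_simps\<close>)
  qed auto
  moreover have "1 ^ k * (DIM('a) * A 0) \<le> (k + DIM('a)) * A k"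
  proof (rule tendsto_le[OF _ tendsto_mult[OF lim tendsto_const] tendsto_mult[OF _ tendsto_mult[OF lim tendsto_const]]])
    show "((\<lambda>r::real. r ^ k) \<longlongrightarrow> 1 ^ k) (at_left 1)" by (intro tendsto_intros)
    show "\<forall>\<^sub>F r in at_left 1. r ^ k * ((1 - r ^ DIM('a)) / (1 - r) * A 0) \<le> (1 - r ^ (k + DIM('a))) / (1 - r) * A k"
      using pos by eventually_elim (use lower in \<open>auto simp: divide_simps\<close>)
  qed auto
  ultimately show ?thesis by (simp add: A_def)
qed

text \<open>Adding the constant \<open>C\<close> makes \<open>H\<close> nonnegative; the identity
  for the constant alone is then subtracted.\<close>

lemma integral_norm_power_ball:
  fixes H :: "'a::euclidean_space \<Rightarrow> real"
  assumes H[measurable]: "H \<in> borel_measurable borel" and hom: "\<And>r z. r > 0 \<Longrightarrow> H (r *\<^sub>R z) = H z"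
    and bd: "\<And>z. \<bar>H z\<bar> \<le> C"
  shows "(k + DIM('a)) * (LINT z:ball 0 1|lborel. norm z ^ k * H z) = DIM('a) * (LINT z:ball 0 1|lborel. H z)"
proof -
  have 1: "(k + DIM('a)) * (LINT z:ball 0 1|lborel. norm z ^ k * (H z + C)) = DIM('a) * (LINT z:ball 0 1|lborel. H z + C)"
  proof (rule integral_norm_power_ball_nonneg[where C = "2 * C"])
    show "(\<lambda>z. H z + C) \<in> borel_measurable borel" by simp
    show "H (r *\<^sub>R z) + C = H z + C" if "r > 0" for r z using hom that by simp
    show "\<bar>H z + C\<bar> \<le> 2 * C" "H z + C \<ge> 0" for z using bd[of z] by linarith+
  qed
  have 2: "(k + DIM('a)) * (LINT z:(ball 0 1 :: 'a set)|lborel. norm z ^ k * C) = DIM('a) * (LINT z:(ball 0 1 :: 'a set)|lborel. C)"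
    using bd[of 0] by (intro integral_norm_power_ball_nonneg[of "\<lambda>_. C" C]) auto
  have int: "set_integrable lborel (ball 0 1) (\<lambda>z. norm z ^ j * H z)"
    "set_integrable lborel (ball 0 1) (\<lambda>z::'a. norm z ^ j * C)" for j
    by (rule set_integrable_norm_power[OF H bd]; simp)
       (rule set_integrable_norm_power[of "\<lambda>_. C" C]; use bd[of 0] in simp)
  show ?thesis
    using 1 2 int[of k] int[of 0]
    by (simp add: distrib_left set_integral_add)
qed

text \<open>The difference quotients of \<open>\<psi>\<close> along \<open>p\<close> integrate to
  \<open>0\<close> by translation invariance. Steps of size at most \<open>1\<close> keep their
  support in \<open>cball 0 2\<close> and the mean value theorem bounds them by \<open>C\<close>, so
  dominated convergence applies.\<close>

lemma integral_directional_derivative_eq_0: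
  fixes \<psi> :: "'a::euclidean_space \<Rightarrow> real"
  assumes [measurable]: "\<psi> \<in> borel_measurable borel" "\<psi>' \<in> borel_measurable borel"
    and der: "\<And>z s. ((\<lambda>s. \<psi> (z + s *\<^sub>R p)) has_real_derivative \<psi>' (z + s *\<^sub>R p)) (at s)"
    and bd: "\<And>z. \<bar>\<psi> z\<bar> \<le> C" "\<And>z. \<bar>\<psi>' z\<bar> \<le> C"
    and supp: "\<And>z. norm z \<ge> 1 \<Longrightarrow> \<psi> z = 0"
    and p: "norm p \<le> 1"
  shows "(LINT z|lborel. \<psi>' z) = 0"
proof -
  define h where "h = (\<lambda>i. inverse (real (Suc i)))"
  have h: "0 < h i" "h i \<le> 1" for i by (auto simp: h_def inverse_le_1_iff)
  let ?q = "\<lambda>i z. (\<psi> (z + h i *\<^sub>R p) - \<psi> z) / h i"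
  have int: "integrable lborel \<psi>"
  proof (rule Bochner_Integration.integrable_bound)
    show "integrable lborel (\<lambda>z::'a. indicat_real (ball 0 1) z * C)"
      using emeasure_lborel_ball_finite by (intro integrable_mult_left integrable_real_indicator) auto
    show "AE z in lborel. norm (\<psi> z) \<le> norm (indicat_real (ball 0 1) z * C)"
      using supp bd(1) by (auto simp: indicator_def intro!: AE_I2 order_trans[OF bd(1)])
  qed auto
  have trans: "distr lborel borel ((+) v) = (lborel :: 'a measure)" for v
    by (rule lborel_distr_plus)
  have int_trans: "integrable lborel (\<lambda>z. \<psi> (z + v))" for v
    using int by (subst (asm) trans[of v, symmetric]) (simp add: integrable_distr_eq add.commute)
  have "(LINT z|lborel. \<psi> (z + v)) = (LINT z|lborel. \<psi> z)" for v
    by (subst (2) trans[of v, symmetric]) (simp add: integral_distr add.commute)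
  then have q0: "(LINT z|lborel. ?q i z) = 0" for i
    using int int_trans by simp
  have "(\<lambda>i. LINT z|lborel. ?q i z) \<longlonglongrightarrow> (LINT z|lborel. \<psi>' z)"
  proof (rule integral_dominated_convergence[where w = "\<lambda>z. indicat_real (cball 0 2) z * C"])
    show "integrable lborel (\<lambda>z::'a. indicat_real (cball 0 2) z * C)"
      using emeasure_lborel_cball_finite by (intro integrable_mult_left integrable_real_indicator) auto
    have "h \<longlonglongrightarrow> 0" unfolding h_def by (rule LIMSEQ_inverse_real_of_nat)
    then have hat: "filterlim h (at 0) sequentially"
      using h(1) by (intro filterlim_atI) (auto intro!: always_eventually simp: less_imp_neq[symmetric])
    have "(\<lambda>i. ?q i z) \<longlonglongrightarrow> \<psi>' z" for z
    proof -
      have "((\<lambda>s. (\<psi> (z + s *\<^sub>R p) - \<psi> z) / s) \<longlongrightarrow> \<psi>' z) (at 0)"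
        using der[of z 0] by (simp add: DERIV_def)
      from filterlim_compose[OF this hat] show ?thesis .
    qed
    then show "AE z in lborel. (\<lambda>i. ?q i z) \<longlonglongrightarrow> \<psi>' z" by simp
    have "norm (?q i z) \<le> indicat_real (cball 0 2) z * C" for i z
    proof (cases "norm z \<le> 2")
      case True
      obtain \<xi> where "\<psi> (z + h i *\<^sub>R p) - \<psi> (z + 0 *\<^sub>R p) = (h i - 0) * \<psi>' (z + \<xi> *\<^sub>R p)"
        using MVT2[of 0 "h i" "\<lambda>s. \<psi> (z + s *\<^sub>R p)" "\<lambda>s. \<psi>' (z + s *\<^sub>R p)"] h(1)[of i] der by auto
      then have "?q i z = \<psi>' (z + \<xi> *\<^sub>R p)" using h(1)[of i] by simp
      then show ?thesis using True bd(2) by simp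
    next
      case False
      have "norm (h i *\<^sub>R p) \<le> 1" using h[of i] p by (simp add: mult_le_one)
      then have "norm (z + h i *\<^sub>R p) \<ge> 1"
        using False norm_triangle_ineq4[of "z + h i *\<^sub>R p" "h i *\<^sub>R p"] by simp
      then show ?thesis using False supp by simp
    qed
    then show "AE z in lborel. norm (?q i z) \<le> indicat_real (cball 0 2) z * C" for i by simp
  qed auto
  then show ?thesis unfolding q0 using LIMSEQ_const_iff by metis
qed

text \<open>At \<open>0\<close> the difference quotient is at most \<open>\<bar>h\<bar>\<close> in
  size. The squared positive part serves as the cutoff that vanishes outside the ball.\<close>

lemma DERIV_max_0_square:
  "((\<lambda>u::real. (max 0 u)\<^sup>2) has_real_derivative 2 * max 0 u) (at u)"
proof -
  consider "u < 0" | "u = 0" | "u > 0" by linarith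
  then show ?thesis
  proof cases
    case 1
    have "((\<lambda>u::real. 0) has_real_derivative 2 * max 0 u) (at u)" using 1 by simp
    then show ?thesis
      by (rule has_field_derivative_transform_within_open[of _ _ _ "{..<0}"]) (use 1 in auto)
  next
    case 2
    have "((\<lambda>h::real. (max 0 h)\<^sup>2 / h) \<longlongrightarrow> 0) (at 0)"
    proof (rule Lim_null_comparison)
      show "\<forall>\<^sub>F h in at 0. norm ((max 0 h)\<^sup>2 / h) \<le> \<bar>h::real\<bar>"
        by (auto intro!: always_eventually simp: max_def power2_eq_square)
      show "((\<lambda>h::real. \<bar>h\<bar>) \<longlongrightarrow> 0) (at 0)" by (rule tendsto_rabs_zero) (rule tendsto_ident_at)
    qed
    then show ?thesis by (simp add: DERIV_def 2)
  next
    case 3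
    have "((\<lambda>u::real. u\<^sup>2) has_real_derivative 2 * max 0 u) (at u)" 
      using 3 by (auto intro!: derivative_eq_intros)
    then show ?thesis
      by (rule has_field_derivative_transform_within_open[of _ _ _ "{0<..}"]) (use 3 in auto)
  qed
qed

text \<open>The second difference of the reciprocals is \<open>8 / (s * (s + 2) * (s + 4))\<close>
  and the first difference on the right is \<open>2 / ((s + 2) * (s + 4))\<close>. Such quotients
  arise from radial integrals whose exponents differ by \<open>2\<close>.\<close>

lemma second_difference_reciprocal:
  fixes s :: real
  assumes eq: "n * (x / s - 2 * (x / (s + 2)) + x / (s + 4)) = 4 * (y / (s + 2) - y / (s + 4))"
    and s: "s > 0"
  shows "s * y = n * x"
proof -
  define u v w a b where uvw: "u = x / s" "v = x / (s + 2)" "w = x / (s + 4)" "a = y / (s + 2)" "b = y / (s + 4)"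
  have x: "x = u * s" "x = v * (s + 2)" "x = w * (s + 4)" and y: "y = a * (s + 2)" "y = b * (s + 4)"
    using s by (simp_all add: uvw)
  have "n * (u - 2 * v + w) = 4 * (a - b)"
    unfolding uvw by (rule eq)
  then have "(n * (u - 2 * v + w)) * (s * (s + 2) * (s + 4)) = (4 * (a - b)) * (s * (s + 2) * (s + 4))"
    by (rule arg_cong)
  moreover have "(n * (u - 2 * v + w)) * (s * (s + 2) * (s + 4)) 
     = n * ((u * s) * ((s + 2) * (s + 4)) - 2 * (v * (s + 2)) * (s * (s + 4)) + (w * (s + 4)) * (s * (s + 2)))"
    by (simp add: algebra_simps)
  moreover have "(4 * (a - b)) * (s * (s + 2) * (s + 4)) = 4 * s * ((a * (s + 2)) * (s + 4) - (b * (s + 4)) * (s + 2))"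
    by (simp add: algebra_simps)
  ultimately have "n * (x * ((s + 2) * (s + 4)) - 2 * x * (s * (s + 4)) + x * (s * (s + 2)))
    = 4 * s * (y * (s + 4) - y * (s + 2))"
    unfolding x[symmetric] y[symmetric] by (simp only:)
  moreover have "n * (x * ((s + 2) * (s + 4)) - 2 * x * (s * (s + 4)) + x * (s * (s + 2))) = 8 * (n * x)"
    by (simp add: algebra_simps)
  moreover have "4 * s * (y * (s + 4) - y * (s + 2)) = 8 * (s * y)"
    by (simp add: algebra_simps)
  ultimately show ?thesis by simp
qed

text \<open>The divergence theorem in \<open>\<real>\<^sup>D\<close>, in the direction \<open>p\<close>, for \<open>(p \<bullet> z) ^ n\<close> times the \<open>C\<^sup>1\<close> cutoff
  \<open>max 0 (1 - z \<bullet> z)\<close> squared: only translation invariance of Lebesgue measure is needed.\<close>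

lemma integral_sphere_inner_power_rec:
  fixes p :: "'a::euclidean_space"
  assumes p: "norm p = 1"
  shows "(real n - 1 + DIM('a)) * (LINT y|sphere_vol. (p \<bullet> y) ^ (n + 1)) = n * (LINT y|sphere_vol. (p \<bullet> y) ^ (n - 1))"
proof -
  define H where "H = (\<lambda>n z. (p \<bullet> (z /\<^sub>R norm z)) ^ n)"
  define S where "S = (\<lambda>n. LINT y|sphere_vol. (p \<bullet> y) ^ n)"
  have Hm[measurable]: "H n \<in> borel_measurable borel" for n
    unfolding H_def by measurable
  have Hh: "H n (r *\<^sub>R z) = H n z" if "r > 0" for n r z
    using that by (simp add: H_def field_simps)
  have Hb: "\<bar>H n z\<bar> \<le> 1" for n z
  proof -
    have "\<bar>p \<bullet> (z /\<^sub>R norm z)\<bar> \<le> norm p * norm (z /\<^sub>R norm z)" by (rule Cauchy_Schwarz_ineq2)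
    also have "\<dots> \<le> 1" using p by (cases "z = 0") auto
    finally show ?thesis unfolding H_def power_abs by (intro power_le_one) auto
  qed
  have HS: "S n = DIM('a) * (LINT z:ball 0 1|lborel. H n z)" for n
    unfolding S_def H_def by (rule integral_sphere_vol) measurable
  \<comment> \<open>Radius and direction separate: the factor \<open>norm z ^ k\<close> contributes
    only the denominator.\<close>
  have A: "(LINT z:ball 0 1|lborel. norm z ^ k * H n z) = S n / (real k + DIM('a))" for k n
  proof -
    have "real k + DIM('a) > 0" using DIM_positive[where 'a='a] by linarith
    then show ?thesis
      using integral_norm_power_ball[OF Hm Hh Hb, of k n] unfolding HS
      by (simp add: eq_divide_eq mult.commute)
  qed
  have int: "set_integrable lborel (ball 0 1) (\<lambda>z. norm z ^ k * H n z)" for k n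
    by (rule set_integrable_norm_power[OF Hm Hb]) auto
  have pH: "(p \<bullet> z) ^ n = norm z ^ n * H n z" for z n
  proof (cases "z = 0")
    case True
    then show ?thesis by (cases n) (auto simp: H_def)
  next
    case False
    then have "p \<bullet> z = norm z * (p \<bullet> (z /\<^sub>R norm z))" by simp
    then show ?thesis by (simp only: H_def power_mult_distrib[symmetric])
  qed
  let ?w = "\<lambda>z. max 0 (1 - z \<bullet> z)"
  define \<psi> where "\<psi> = (\<lambda>z. (p \<bullet> z) ^ n * (?w z)\<^sup>2)"
  define \<psi>' where "\<psi>' = (\<lambda>z. n * (p \<bullet> z) ^ (n - 1) * (?w z)\<^sup>2 - 4 * (p \<bullet> z) ^ (n + 1) * ?w z)"
  have small: "\<bar>(p \<bullet> z) ^ k * (?w z) ^ Suc j\<bar> \<le> 1" for z k j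
  proof (cases "norm z \<le> 1")
    case True
    then have "\<bar>p \<bullet> z\<bar> \<le> 1" using Cauchy_Schwarz_ineq2[of p z] p by simp
    moreover have "?w z \<le> 1" by simp
    ultimately show ?thesis
      by (simp only: abs_mult power_abs) (intro mult_le_one power_le_one zero_le_power, auto)
  next
    case False
    then have "?w z = 0" by (simp add: max_def dot_square_norm power2_eq_square) (smt (verit) mult_less_cancel_left1)
    then show ?thesis by simp
  qed
  \<comment> \<open>The bound \<open>n + 4\<close> adds up the coefficients of
    \<open>\<psi>'\<close>, whose remaining factors are at most \<open>1\<close> by
    \<open>small\<close>.\<close>
  have zero: "(LINT z|lborel. \<psi>' z) = 0"
  proof (rule integral_directional_derivative_eq_0[of \<psi> \<psi>' p "n + 4"])
    show "\<psi> \<in> borel_measurable borel" "\<psi>' \<in> borel_measurable borel"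
      unfolding \<psi>_def \<psi>'_def by measurable
    fix z :: 'a
    show "\<bar>\<psi> z\<bar> \<le> real (n + 4)" using small[of z n 1] by (simp add: \<psi>_def numeral_2_eq_2)
    have "\<psi>' z = n * ((p \<bullet> z) ^ (n - 1) * (?w z) ^ Suc 1) - 4 * ((p \<bullet> z) ^ (n + 1) * ?w z ^ Suc 0)"
      unfolding \<psi>'_def by (simp only: power_Suc power2_eq_square power_0 mult_1_right One_nat_def mult.assoc)
    then have "\<bar>\<psi>' z\<bar> \<le> n * \<bar>(p \<bullet> z) ^ (n - 1) * (?w z) ^ Suc 1\<bar> + 4 * \<bar>(p \<bullet> z) ^ (n + 1) * ?w z ^ Suc 0\<bar>"
      using abs_triangle_ineq4[of "n * ((p \<bullet> z) ^ (n - 1) * (?w z) ^ Suc 1)" "4 * ((p \<bullet> z) ^ (n + 1) * ?w z ^ Suc 0)"]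
      by (simp only: abs_mult abs_of_nat abs_numeral)
    also have "\<dots> \<le> real n * 1 + 4 * 1" by (intro add_mono mult_left_mono small) auto
    finally show "\<bar>\<psi>' z\<bar> \<le> real (n + 4)" by simp
    show "\<psi> z = 0" if "norm z \<ge> 1"
    proof -
      have "z \<bullet> z \<ge> 1" using that by (simp add: dot_square_norm)
      then show ?thesis by (simp add: \<psi>_def)
    qed
    fix s
    have "((\<lambda>s. 1 - (z + s *\<^sub>R p) \<bullet> (z + s *\<^sub>R p)) has_real_derivative - 2 * (p \<bullet> (z + s *\<^sub>R p))) (at s)"
      unfolding has_field_derivative_def
      by (auto intro!: derivative_eq_intros simp: fun_eq_iff inner_commute algebra_simps)
    note w = DERIV_chain2[OF DERIV_max_0_square this]
    have "((\<lambda>s. p \<bullet> (z + s *\<^sub>R p)) has_real_derivative 1) (at s)"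
      unfolding has_field_derivative_def
      using p by (auto intro!: derivative_eq_intros simp: fun_eq_iff norm_eq_1)
    from DERIV_mult[OF DERIV_power[OF this, of n] w]
    show "((\<lambda>s. \<psi> (z + s *\<^sub>R p)) has_real_derivative \<psi>' (z + s *\<^sub>R p)) (at s)"
      unfolding \<psi>_def \<psi>'_def by (rule DERIV_cong) (simp add: algebra_simps)
  qed (use p in simp)
  have "(LINT z|lborel. \<psi>' z) = (LINT z:ball 0 1|lborel.
       n * (norm z ^ (n - 1) * H (n - 1) z - 2 * (norm z ^ (n - 1 + 2) * H (n - 1) z) + norm z ^ (n - 1 + 4) * H (n - 1) z)
       - 4 * (norm z ^ (n + 1) * H (n + 1) z - norm z ^ (n + 3) * H (n + 1) z))"
    unfolding set_lebesgue_integral_def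
  proof (intro Bochner_Integration.integral_cong refl)
    fix z :: 'a
    have w: "?w z = indicat_real (ball 0 1) z * (1 - (norm z)\<^sup>2)"
      by (auto simp: max_def dot_square_norm indicator_def abs_square_le_1)
    show "\<psi>' z = indicat_real (ball 0 1) z *\<^sub>R (n * (norm z ^ (n - 1) * H (n - 1) z - 2 * (norm z ^ (n - 1 + 2) * H (n - 1) z) + norm z ^ (n - 1 + 4) * H (n - 1) z)
       - 4 * (norm z ^ (n + 1) * H (n + 1) z - norm z ^ (n + 3) * H (n + 1) z))"
    proof (cases "norm z < 1")
      case True
      have pw: "norm z ^ (n - 1 + 2) = norm z ^ (n - 1) * (norm z)\<^sup>2"
        "norm z ^ (n - 1 + 4) = norm z ^ (n - 1) * (norm z)\<^sup>2 * (norm z)\<^sup>2"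
        "norm z ^ (n + 3) = norm z ^ (n + 1) * (norm z)\<^sup>2"
        by (simp_all add: power_add power2_eq_square eval_nat_numeral)
      have "indicat_real (ball 0 1) z = 1" using True by simp
      have alg: "x * (a * h) * (1 * (1 - u))\<^sup>2 - 4 * (b * g) * (1 * (1 - u))
          = 1 * (x * (a * h - 2 * (a * u * h) + a * u * u * h) - 4 * (b * g - b * u * g))"
        for x a h u b g :: real
        by (simp add: power2_eq_square algebra_simps)
      show ?thesis
        unfolding \<psi>'_def w pH pw \<open>indicat_real (ball 0 1) z = 1\<close> real_scaleR_def by (rule alg)
    next
      case False
      then show ?thesis by (simp add: \<psi>'_def w)
    qed
  qed
  also have "\<dots> = n * (S (n - 1) / (real (n - 1) + DIM('a)) - 2 * (S (n - 1) / (real (n - 1 + 2) + DIM('a))) + S (n - 1) / (real (n - 1 + 4) + DIM('a)))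
       - 4 * (S (n + 1) / (real (n + 1) + DIM('a)) - S (n + 1) / (real (n + 3) + DIM('a)))"
  proof -
    have "(LINT z:ball 0 1|lborel. x * (f1 z - 2 * f2 z + f3 z) - 4 * (f4 z - f5 z))
       = x * ((LINT z:ball 0 1|lborel. f1 z) - 2 * (LINT z:ball 0 1|lborel. f2 z) + (LINT z:ball 0 1|lborel. f3 z))
         - 4 * ((LINT z:ball 0 1|lborel. f4 z) - (LINT z:ball 0 1|lborel. f5 z))"
      if "set_integrable lborel (ball 0 1) f1" "set_integrable lborel (ball 0 1) f2" "set_integrable lborel (ball 0 1) f3"
        "set_integrable lborel (ball 0 1) f4" "set_integrable lborel (ball 0 1) f5"
      for x and f1 f2 f3 f4 f5 :: "'a \<Rightarrow> real"
      using that by (simp add: set_integral_diff set_integral_add)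
    from this[OF int int int int int] show ?thesis unfolding A .
  qed
  finally have eq: "n * (S (n - 1) / (real (n - 1) + DIM('a)) - 2 * (S (n - 1) / (real (n - 1 + 2) + DIM('a))) + S (n - 1) / (real (n - 1 + 4) + DIM('a)))
       = 4 * (S (n + 1) / (real (n + 1) + DIM('a)) - S (n + 1) / (real (n + 3) + DIM('a)))"
    unfolding zero by (simp only: eq_commute[of 0] right_minus_eq)
  define s where "s = real n - 1 + DIM('a)"
  have D: "real DIM('a) \<ge> 1" using DIM_positive[where 'a='a] by linarith
  have e: "real (n + 1) + DIM('a) = s + 2" "real (n + 3) + DIM('a) = s + 4"
    by (auto simp: s_def)
  \<comment> \<open>For \<open>n = 0\<close> the truncated \<open>n - 1\<close> does not fit
    \<open>s\<close>, which may also vanish; the first moment is then shown to be \<open>0\<close>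
    directly.\<close>
  have "s * S (n + 1) = n * S (n - 1)"
  proof (cases "n = 0")
    case True
    have "S (n + 1) / (s + 2) = S (n + 1) / (s + 4)"
      using eq unfolding e by (simp only: True of_nat_0 mult_zero_left) simp
    moreover have "s + 2 > 0" "s + 4 > 0" using D by (auto simp: s_def)
    ultimately have "S (n + 1) * (s + 4) = S (n + 1) * (s + 2)"
      by (subst (asm) frac_eq_eq) auto
    then have "S (n + 1) = 0" by (simp add: distrib_left)
    then show ?thesis by (simp only: True of_nat_0 mult_zero_left mult_zero_right)
  next
    case False
    have e': "real (n - 1) + DIM('a) = s" "real (n - 1 + 2) + DIM('a) = s + 2" "real (n - 1 + 4) + DIM('a) = s + 4"
      and s: "s > 0" using False D by (auto simp: s_def of_nat_diff intro!: add_nonneg_pos)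
    show ?thesis
      using eq unfolding e e' by (rule second_difference_reciprocal[OF _ s])
  qed
  then show ?thesis by (simp only: s_def S_def)
qed

section \<open>Moments of \<open>half_cos\<close> by integration by parts on the sphere\<close>

lemma integrable_sphere_vol_continuous:
  fixes f :: "'a::euclidean_space \<Rightarrow> real"
  assumes f: "continuous_on UNIV f"
  shows "integrable sphere_vol f"
proof -
  have "bounded (f ` unit_sphere)"
    using f by (intro compact_imp_bounded compact_continuous_image) (auto intro: continuous_on_subset)
  then obtain B where B: "\<And>y. y \<in> unit_sphere \<Longrightarrow> norm (f y) \<le> B"
    unfolding bounded_iff by blast
  show ?thesis
  proof (rule finite_measure.integrable_const_bound[OF finite_measure_sphere_vol])
    show "AE y in sphere_vol. norm (f y) \<le> B"
      using B by (intro AE_I2) simp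
    show "f \<in> borel_measurable sphere_vol"
      using f by (intro measurable_sphere_vol_borel borel_measurable_continuous_onI)
  qed
qed

text \<open>The divergence theorem for the tangent field \<open>poly q (p \<bullet> y) *\<^sub>R (p
  - (p \<bullet> y) *\<^sub>R y)\<close>. By linearity monomials suffice, and for them it is the
  recursion \<open>integral_sphere_inner_power_rec\<close>.\<close>

lemma integral_sphere_poly_identity:
  fixes p :: "'a::euclidean_space" and q :: "real poly"
  assumes p: "norm p = 1"
  shows "(LINT y|sphere_vol. (1 - (p \<bullet> y)\<^sup>2) * poly (pderiv q) (p \<bullet> y)
            - (real DIM('a) - 1) * (p \<bullet> y) * poly q (p \<bullet> y)) = 0"
proof -
  let ?T = "\<lambda>q y. (1 - (p \<bullet> y)\<^sup>2) * poly (pderiv q) (p \<bullet> y) - (real DIM('a) - 1) * (p \<bullet> y) * poly q (p \<bullet> y)"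
  have int: "integrable sphere_vol (?T q)" for q
    by (intro integrable_sphere_vol_continuous continuous_intros)
  have monom: "(LINT y|sphere_vol. ?T (monom c n) y) = 0" for c n
  proof -
    have intp: "integrable sphere_vol (\<lambda>y. (p \<bullet> y) ^ k)" for k
      by (intro integrable_sphere_vol_continuous continuous_intros)
    have "?T (monom c n) y = c * (n * (p \<bullet> y) ^ (n - 1) - (real n - 1 + DIM('a)) * (p \<bullet> y) ^ (n + 1))" for y
      by (cases n) (simp_all add: pderiv_monom poly_monom power2_eq_square algebra_simps)
    then have "(LINT y|sphere_vol. ?T (monom c n) y) 
       = c * (n * (LINT y|sphere_vol. (p \<bullet> y) ^ (n - 1)) - (real n - 1 + DIM('a)) * (LINT y|sphere_vol. (p \<bullet> y) ^ (n + 1)))"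
      using intp by (simp del: power_Suc)
    then show ?thesis using integral_sphere_inner_power_rec[OF p, of n] by simp
  qed
  have "(LINT y|sphere_vol. ?T (\<Sum>i\<in>I. monom (c i) i) y) = 0" if "finite I" for I c
    using that
  proof (induction I)
    case (insert i I)
    have "?T (\<Sum>i\<in>insert i I. monom (c i) i) y = ?T (monom (c i) i) y + ?T (\<Sum>i\<in>I. monom (c i) i) y" for y
      using insert by (simp add: pderiv_add algebra_simps)
    then show ?case
      using insert int monom by (simp only: Bochner_Integration.integral_add[OF int int])
  qed simp
  from this[of "{..degree q}" "coeff q"] show ?thesis
    by (simp only: poly_as_sum_of_monoms finite_atMost)
qed

text \<open>For unit vectors at angle \<theta> this is the square of the cosine of \<theta>/2, so it
  runs over the unit interval and equals \<open>1\<close> only at \<open>x = y\<close>.\<close>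

definition half_cos :: "'a::euclidean_space \<Rightarrow> 'a \<Rightarrow> real" where
  "half_cos x y = (1 + x \<bullet> y) / 2"

text \<open>The \<open>n\<close>-th moment of the Beta distribution with both parameters \<open>d/2\<close>, which is the law of
  \<open>half_cos p\<close> under the normalised surface measure.\<close>

definition cap_moment :: "real \<Rightarrow> nat \<Rightarrow> real" where
  "cap_moment d n = (\<Prod>k<n. (real k + d / 2) / (real k + d))"

lemma cap_moment_0 [simp]: "cap_moment d 0 = 1"
  by (simp add: cap_moment_def)

lemma cap_moment_Suc: "cap_moment d (Suc n) = cap_moment d n * ((n + d / 2) / (n + d))"
  by (simp add: cap_moment_def)

lemma continuous_on_half_cos [continuous_intros]:
  "continuous_on A f \<Longrightarrow> continuous_on A g \<Longrightarrow> continuous_on A (\<lambda>y. half_cos (f y) (g y))"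
  unfolding half_cos_def by (intro continuous_intros) auto

lemma half_cos_commute: "half_cos x y = half_cos y x"
  by (simp add: half_cos_def inner_commute)

lemma half_cos_bounds:
  assumes "norm x = 1" "norm y = 1"
  shows "0 \<le> half_cos x y" "half_cos x y \<le> 1"
  using Cauchy_Schwarz_ineq2[of x y] assms by (auto simp: half_cos_def)

text \<open>The polynomial identity for \<open>q\<close> equal to the \<open>m\<close>-th power of
  \<open>(1 + t) / 2\<close> relates the moments \<open>m\<close> and \<open>Suc m\<close> by the
  same ratio as \<open>cap_moment_Suc\<close>.\<close>

lemma integral_half_cos_power:
  fixes p :: "'a::euclidean_space"
  assumes p: "norm p = 1" and d: "d = real DIM('a) - 1" "d > 0"
  shows "(LINT y|sphere_vol. half_cos p y ^ n) = measure sphere_vol (unit_sphere :: 'a set) * cap_moment d n"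
proof (induction n)
  case 0
  show ?case using lebesgue_integral_const[of sphere_vol "1::real"] by (simp add: measure_def)
next
  case (Suc m)
  have int: "integrable sphere_vol (\<lambda>y. half_cos p y ^ k)" for k
    by (intro integrable_sphere_vol_continuous continuous_intros)
  let ?q = "[:1/2, 1/2:] ^ m :: real poly"
  have "(1 - (p \<bullet> y)\<^sup>2) * poly (pderiv ?q) (p \<bullet> y) - (real DIM('a) - 1) * (p \<bullet> y) * poly ?q (p \<bullet> y)
     = (2 * m + d) * half_cos p y ^ m - (2 * m + 2 * d) * half_cos p y ^ (Suc m)" for y
  proof -
    let ?z = "half_cos p y"
    have t: "p \<bullet> y = 2 * ?z - 1" by (simp add: half_cos_def field_simps)
    have z: "poly [:1/2, 1/2:] (2 * ?z - 1) = ?z" by (simp add: field_simps)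
    have q': "poly (pderiv ?q) (2 * ?z - 1) = m * ?z ^ (m - 1) / 2"
      unfolding pderiv_power poly_smult poly_mult poly_power z
      by (simp add: pderiv_pCons)
    have q: "poly ?q (2 * ?z - 1) = ?z ^ m"
      unfolding poly_power z ..
    show ?thesis
      unfolding t q q' d(1)[symmetric] by (cases m) (simp_all add: power2_eq_square algebra_simps add_divide_distrib)
  qed
  then have "(LINT y|sphere_vol. (2 * m + d) * half_cos p y ^ m - (2 * m + 2 * d) * half_cos p y ^ (Suc m)) = 0"
    using integral_sphere_poly_identity[OF p, of ?q] by simp
  then have "(2 * m + 2 * d) * (LINT y|sphere_vol. half_cos p y ^ Suc m) = (2 * m + d) * (LINT y|sphere_vol. half_cos p y ^ m)"
    using int[of m] int[of "Suc m"] by simp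
  then show ?case
    using d(2) unfolding Suc.IH cap_moment_Suc by (simp add: field_simps)
qed

lemma measure_sphere_vol_pos: "measure sphere_vol (unit_sphere :: 'a::euclidean_space set) > 0"
proof -
  have "measure sphere_vol (unit_sphere :: 'a set) = (LINT y::'a|sphere_vol. 1)"
    by (simp only: lebesgue_integral_const space_sphere_vol) simp
  also have "\<dots> = DIM('a) * measure lborel (ball 0 1 :: 'a set)"
    by (subst integral_sphere_vol) (auto simp: set_lebesgue_integral_def)
  also have "\<dots> > 0" using content_ball_pos[of 1 "0::'a"] by simp
  finally show ?thesis .
qed

lemma cap_moment_pos: "d > 0 \<Longrightarrow> cap_moment d n > 0"
  unfolding cap_moment_def by (intro prod_pos) (auto intro!: divide_pos_pos add_nonneg_pos)

section \<open>Bounds for the moments\<close>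

text \<open>The convex function \<open>y powr a\<close> lies above its tangent at
  \<open>1\<close>.\<close>

lemma Bernoulli_inequality_powr:
  fixes x a :: real
  assumes "a \<ge> 1" "x > -1"
  shows "1 + a * x \<le> (1 + x) powr a"
proof -
  have "(1 + x) powr a - 1 powr a \<ge> a * ((1 + x) - 1)"
  proof (rule convex_on_imp_above_tangent[where A = "{0<..}"])
    show "((\<lambda>y. y powr a) has_real_derivative a) (at 1 within {0<..})"
      by (auto intro!: derivative_eq_intros)
  qed (use assms powr_convex[of a] in \<open>auto simp: interior_open\<close>)
  then show ?thesis by simp
qed

text \<open>Consecutive reciprocals have ratio \<open>1 + (d / 2) / (n + d / 2)\<close>, which
  Bernoulli's inequality bounds by \<open>((n + 2) / (n + 1)) powr (d / 2)\<close>; the product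
  telescopes.\<close>

lemma inverse_cap_moment_le:
  assumes "d \<ge> 2"
  shows "1 / cap_moment d n \<le> (real n + 1) powr (d / 2)"
proof (induction n)
  case (Suc n)
  have "1 / cap_moment d (Suc n) = (1 / cap_moment d n) * ((n + d) / (n + d / 2))"
    by (simp add: cap_moment_Suc)
  also have "(n + d) / (n + d / 2) = 1 + (d / 2) / (n + d / 2)"
    using assms by (simp add: field_simps add_pos_nonneg)
  also have "\<dots> \<le> 1 + (d / 2) * (1 / (real n + 1))"
    using assms by (intro add_left_mono) (simp add: frac_le)
  also have "\<dots> \<le> (1 + 1 / (real n + 1)) powr (d / 2)"
    by (rule Bernoulli_inequality_powr) (use assms in \<open>auto intro: less_le_trans[of _ 0]\<close>)
  also have "1 + 1 / (real n + 1) = (real (Suc n) + 1) / (real n + 1)" by (simp add: field_simps)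
  finally have "1 / cap_moment d (Suc n) \<le> (1 / cap_moment d n) * ((real (Suc n) + 1) / (real n + 1)) powr (d / 2)"
    using cap_moment_pos[of d n] assms by (simp add: mult_left_mono divide_right_mono)
  also have "\<dots> \<le> (real n + 1) powr (d / 2) * ((real (Suc n) + 1) / (real n + 1)) powr (d / 2)"
    by (intro mult_right_mono Suc) auto
  also have "\<dots> = (real (Suc n) + 1) powr (d / 2)"
    by (simp add: powr_mult[symmetric])
  finally show ?case .
qed simp

text \<open>Bernoulli's inequality with increment \<open>- 1 / (n + d)\<close> bounds each moment
  ratio by \<open>((n + d - 1) / (n + d)) powr (d / 2)\<close>; the product telescopes.\<close>

lemma cap_moment_le:
  assumes "d \<ge> 2"
  shows "cap_moment d n \<le> ((d - 1) / (real n + d - 1)) powr (d / 2)"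
proof (induction n)
  case 0
  then show ?case using assms by simp
next
  case (Suc n)
  have nd: "real n + d > 0" "real n + d - 1 > 0" using assms by linarith+
  have "(n + d / 2) / (n + d) = 1 + (d / 2) * (- 1 / (n + d))"
    using nd by (simp add: field_simps)
  also have "\<dots> \<le> (1 + (- 1 / (n + d))) powr (d / 2)"
    by (rule Bernoulli_inequality_powr) (use assms nd in \<open>auto simp: field_simps\<close>)
  also have "1 + (- 1 / (n + d)) = (real n + d - 1) / (real (Suc n) + d - 1)"
    using nd by (simp add: field_simps)
  finally have "cap_moment d (Suc n) \<le> cap_moment d n * ((real n + d - 1) / (real (Suc n) + d - 1)) powr (d / 2)"
    using cap_moment_pos[of d n] assms unfolding cap_moment_Suc by (intro mult_left_mono) auto
  also have "\<dots> \<le> ((d - 1) / (real n + d - 1)) powr (d / 2) * ((real n + d - 1) / (real (Suc n) + d - 1)) powr (d / 2)"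
    by (intro mult_right_mono Suc) auto
  also have "\<dots> = (((d - 1) / (real n + d - 1)) * ((real n + d - 1) / (real (Suc n) + d - 1))) powr (d / 2)"
    using assms nd by (subst powr_mult[symmetric]) auto
  also have "((d - 1) / (real n + d - 1)) * ((real n + d - 1) / (real (Suc n) + d - 1)) = (d - 1) / (real (Suc n) + d - 1)"
    using nd by simp
  finally show ?case .
qed

text \<open>Moments decay like \<open>k powr (- d / 2)\<close>, so the square is smaller than the
  moment at \<open>2 * k\<close> by a factor of that order, and the threshold makes it at most
  \<open>1 / (4 * N)\<close>. This quantifies that \<open>N\<close> bumps of exponent
  \<open>2 * k\<close> are too narrow to fill the sphere.\<close>

lemma cap_moment_square_bound:
  assumes d: "d \<ge> 2" and N: "N \<ge> 1" and k: "real k \<ge> 3 * d\<^sup>2 * (4 * N) powr (2 / d)"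
  shows "4 * N * (cap_moment d k)\<^sup>2 \<le> cap_moment d (2 * k)"
proof -
  have "(4 * N) powr (2 / d) \<ge> 1" using N d by (intro ge_one_powr_ge_zero) auto
  then have "3 * d\<^sup>2 * (4 * N) powr (2 / d) > 0" using d by (intro mult_pos_pos) auto
  then have k0: "real k > 0" "k \<ge> 1" using k by linarith+
  have "(cap_moment d k)\<^sup>2 \<le> (((d - 1) / (real k + d - 1)) powr (d / 2))\<^sup>2"
    using cap_moment_le[OF d, of k] cap_moment_pos[of d k] d by (intro power_mono) auto
  also have "\<dots> \<le> ((d / k) powr (d / 2))\<^sup>2"
    using d k0 by (intro power_mono powr_mono2 frac_le) auto
  also have "\<dots> = ((d / k)\<^sup>2) powr (d / 2)"
    using d k0 by (simp only: power2_eq_square) (subst powr_mult, auto)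
  finally have 1: "(cap_moment d k)\<^sup>2 \<le> ((d / k)\<^sup>2) powr (d / 2)" .
  \<comment> \<open>The \<open>3\<close> in the threshold comes from
    \<open>2 * k + 1 \<le> 3 * k\<close>.\<close>
  have "1 / cap_moment d (2 * k) \<le> (3 * k) powr (d / 2)"
    by (rule order_trans[OF inverse_cap_moment_le[OF d] powr_mono2]) (use d k0 in auto)
  then have "4 * N * (cap_moment d k)\<^sup>2 * (1 / cap_moment d (2 * k)) \<le> 4 * N * ((d / k)\<^sup>2) powr (d / 2) * (3 * k) powr (d / 2)"
    using 1 N d cap_moment_pos[of d "2 * k"] by (intro mult_mono) auto
  also have "\<dots> = (4 * N) * (3 * d\<^sup>2 / k) powr (d / 2)"
    using d k0 by (simp add: powr_mult[symmetric] power2_eq_square mult_ac)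
  also have "\<dots> \<le> (4 * N) * (1 / ((4 * N) powr (2 / d))) powr (d / 2)"
    using k k0 N d by (intro mult_left_mono powr_mono2) (auto simp: field_simps)
  also have "\<dots> = 1"
    using N d by (simp add: powr_divide powr_powr)
  finally show ?thesis
    using cap_moment_pos[of d "2 * k"] d by (simp add: field_simps)
qed

text \<open>The right-hand side is a telescoping majorant: its increments dominate the summands, because
  \<open>d \<ge> 3\<close> makes it grow like \<open>m powr (d/2 - 1)\<close> with a positive exponent.\<close>

lemma sum_reciprocal_cap_moment:
  assumes d: "d \<ge> 3"
  shows "(\<Sum>k=1..m. 1 / (k * (k + d - 1) * cap_moment d k)) \<le> 4 / ((m + 2) * cap_moment d m)"
proof (induction m)
  case (Suc m)
  define k where "k = real (Suc m)"
  define c where "c = cap_moment d (Suc m)"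
  have c: "c > 0" using cap_moment_pos d by (simp add: c_def)
  have k: "k \<ge> 1" by (simp add: k_def)
  have kd: "k + d - 1 > 0" "k - 1 + d / 2 > 0" using k d by auto
  have cm: "cap_moment d m = c * ((k + d - 1) / (k - 1 + d / 2))"
    using kd by (simp add: c_def cap_moment_Suc k_def add.commute)
  \<comment> \<open>This is the induction step multiplied by \<open>c\<close>; the moments have
    dropped out and a rational inequality in \<open>k\<close> remains.\<close>
  have "1 / (k * (k + d - 1)) + 4 * ((k - 1 + d / 2) / ((k + 1) * (k + d - 1))) \<le> 4 / (k + 2)"
  proof -
    have "(k + 1) * (k + 2) + 4 * (k * (k - 1 + d / 2) * (k + 2)) \<le> 4 * (k * (k + 1) * (k + d - 1))"
    proof -
      \<comment> \<open>The leading terms cancel and leave the coefficient \<open>d / 2 - 1\<close>,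
        which is at least \<open>1 / 2\<close> because \<open>d \<ge> 3\<close>.\<close>
      have "4 * (k * (k + 1) * (k + d - 1)) - 4 * (k * (k - 1 + d / 2) * (k + 2)) = 4 * (k * ((d / 2 - 1) * k + 1))"
        by (simp add: algebra_simps)
      also have "\<dots> \<ge> 4 * (k * ((1 / 2) * k + 1))"
        using k d by (intro mult_left_mono add_right_mono mult_right_mono) auto
      moreover have "(k + 1) * (k + 2) \<le> 4 * (k * ((1 / 2) * k + 1))"
      proof -
        have "k * 1 \<le> k * k" using k by (intro mult_left_mono) auto
        then have "2 \<le> k + k * k" using k by linarith
        then show ?thesis by (simp add: algebra_simps)
      qed
      ultimately show ?thesis by linarith
    qed
    then have "((k + 1) * (k + 2) + 4 * (k * (k - 1 + d / 2) * (k + 2))) / (k * (k + 1) * (k + 2) * (k + d - 1))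
       \<le> (4 * (k * (k + 1) * (k + d - 1))) / (k * (k + 1) * (k + 2) * (k + d - 1))"
      using k kd by (intro divide_right_mono) auto
    moreover have "(4 * (k * (k + 1) * (k + d - 1))) / (k * (k + 1) * (k + 2) * (k + d - 1)) = 4 / (k + 2)"
    proof -
      have "(4 * (k * (k + 1) * x)) / (k * (k + 1) * (k + 2) * x) = 4 / (k + 2)" if "x > 0" for x
        using k that by simp
      from this[OF kd(1)] show ?thesis .
    qed
    moreover have "((k + 1) * (k + 2) + 4 * (k * (k - 1 + d / 2) * (k + 2))) / (k * (k + 1) * (k + 2) * (k + d - 1))
      = 1 / (k * (k + d - 1)) + 4 * ((k - 1 + d / 2) / ((k + 1) * (k + d - 1)))"
    proof -
      have "((k + 1) * (k + 2) + 4 * (k * w * (k + 2))) / (k * (k + 1) * (k + 2) * x) = 1 / (k * x) + 4 * (w / ((k + 1) * x))"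
        if "x > 0" for x w
      proof -
        have "(k + 1) * (k + 2) / (k * (k + 1) * (k + 2) * x) = 1 / (k * x)"
          "4 * (k * w * (k + 2)) / (k * (k + 1) * (k + 2) * x) = 4 * (w / ((k + 1) * x))"
          using k that by (simp_all add: divide_simps)
        then show ?thesis unfolding add_divide_distrib by (simp only:)
      qed
      from this[OF kd(1)] show ?thesis .
    qed
    ultimately show ?thesis by simp
  qed
  then have "(1 / (k * (k + d - 1)) + 4 * ((k - 1 + d / 2) / ((k + 1) * (k + d - 1)))) / c \<le> 4 / (k + 2) / c"
    using c by (intro divide_right_mono) auto
  then have *: "1 / (k * (k + d - 1) * c) + 4 / ((k + 1) * cap_moment d m) \<le> 4 / ((k + 2) * c)"
  proof -
    have "(1 / u + 4 * (w / ((k + 1) * x))) / c = 1 / (u * c) + 4 / ((k + 1) * (c * (x / w)))" for u w x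
      by (simp add: add_divide_distrib mult_ac)
    then show ?thesis
      using \<open>_ / c \<le> 4 / (k + 2) / c\<close> unfolding cm by (simp only: divide_divide_eq_left)
  qed
  have "real m + 2 = k + 1" "real (Suc m) + 2 = k + 2" by (auto simp: k_def)
  then have "(\<Sum>k=1..m. 1 / (k * (k + d - 1) * cap_moment d k)) \<le> 4 / ((k + 1) * cap_moment d m)"
    using Suc by (simp only:)
  moreover have "(\<Sum>k=1..Suc m. 1 / (k * (k + d - 1) * cap_moment d k))
      = (\<Sum>k=1..m. 1 / (k * (k + d - 1) * cap_moment d k)) + 1 / (k * (k + d - 1) * c)"
    by (simp add: k_def c_def)
  ultimately show ?case
    using * unfolding \<open>real (Suc m) + 2 = k + 2\<close> c_def[symmetric] by linarith
qed (use d in simp)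

section \<open>Positive definiteness\<close>

text \<open>\<open>half_cos\<close> is \<open>1 / 2\<close> plus half a sum of coordinate products,
  and products of features are features of a product of kernels. The finite expansion lets positive
  semidefiniteness be read off from squares and lets features be averaged over the sphere.\<close>

lemma half_cos_power_feature_expansion:
  "\<exists>n (\<phi> :: nat \<Rightarrow> 'a::euclidean_space \<Rightarrow> real). (\<forall>i. continuous_on UNIV (\<phi> i)) \<and>
     (\<forall>x y. half_cos x y ^ k = (\<Sum>i<n. \<phi> i x * \<phi> i y))"
proof -
  have "\<exists>L :: ('a \<Rightarrow> real) list. (\<forall>\<phi>\<in>set L. continuous_on UNIV \<phi>) \<and>
     (\<forall>x y. half_cos x y ^ k = (\<Sum>\<phi>\<leftarrow>L. \<phi> x * \<phi> y))"
  proof (induction k)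
    case 0
    show ?case by (rule exI[of _ "[\<lambda>_. 1]"]) auto
  next
    case (Suc k)
    then obtain L where L: "\<forall>\<phi>\<in>set L. continuous_on UNIV \<phi>" "\<And>x y. half_cos x y ^ k = (\<Sum>\<phi>\<leftarrow>L. \<phi> x * \<phi> (y::'a))"
      by auto
    obtain bs where bs: "set bs = (Basis :: 'a set)" "distinct bs"
      using finite_distinct_list[OF finite_Basis] by blast
    define M where "M = (\<lambda>_. sqrt (1/2)) # map (\<lambda>b x. sqrt (1/2) * (x \<bullet> b)) bs"
    have "half_cos x y = (\<Sum>\<phi>\<leftarrow>M. \<phi> x * \<phi> y)" for x y :: 'a
    proof -
      have "(\<Sum>\<phi>\<leftarrow>M. \<phi> x * \<phi> y) = 1 / 2 + (\<Sum>b\<leftarrow>bs. (x \<bullet> b) * (y \<bullet> b) / 2)"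
        by (simp add: M_def o_def real_sqrt_mult_self mult_ac)
      also have "(\<Sum>b\<leftarrow>bs. (x \<bullet> b) * (y \<bullet> b) / 2) = (\<Sum>b\<in>Basis. (x \<bullet> b) * (y \<bullet> b) / 2)"
        using bs by (simp add: sum_list_distinct_conv_sum_set)
      finally show ?thesis
        by (simp add: half_cos_def euclidean_inner[of x y] sum_divide_distrib[symmetric] add_divide_distrib)
    qed
    moreover have "(\<Sum>\<xi>\<leftarrow>concat (map (\<lambda>\<phi>. map (\<lambda>\<psi> z. \<phi> z * \<psi> z) M) L). \<xi> x * \<xi> y)
      = (\<Sum>\<phi>\<leftarrow>L. \<phi> x * \<phi> y) * (\<Sum>\<psi>\<leftarrow>M. \<psi> x * \<psi> y)" for x y
    proof -
      have "(\<Sum>\<psi>\<leftarrow>M'. a x * \<psi> x * (a y * \<psi> y)) = a x * a y * (\<Sum>\<psi>\<leftarrow>M'. \<psi> x * \<psi> y)"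
        for a and M' :: "('a \<Rightarrow> real) list"
        by (induction M') (simp_all add: algebra_simps)
      then show ?thesis by (induction L) (simp_all add: distrib_right o_def)
    qed
    ultimately have "half_cos x y ^ Suc k = (\<Sum>\<xi>\<leftarrow>concat (map (\<lambda>\<phi>. map (\<lambda>\<psi> z. \<phi> z * \<psi> z) M) L). \<xi> x * \<xi> y)" for x y
      using L(2) by (simp add: mult.commute)
    moreover have "\<forall>\<xi>\<in>set (concat (map (\<lambda>\<phi>. map (\<lambda>\<psi> z. \<phi> z * \<psi> z) M) L)). continuous_on UNIV \<xi>"
      using L(1) by (auto simp: M_def intro!: continuous_intros)
    ultimately show ?case by blast
  qed
  then obtain L :: "('a \<Rightarrow> real) list" where L: "\<forall>\<phi>\<in>set L. continuous_on UNIV \<phi>"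
    "\<And>x y. half_cos x y ^ k = (\<Sum>\<phi>\<leftarrow>L. \<phi> x * \<phi> y)" by auto
  \<comment> \<open>Padding with the zero function makes continuity hold for every index.\<close>
  let ?\<phi> = "\<lambda>i. if i < length L then L ! i else (\<lambda>_. 0)"
  have "continuous_on UNIV (?\<phi> i)" for i using L(1) by auto
  moreover have "half_cos x y ^ k = (\<Sum>i<length L. ?\<phi> i x * ?\<phi> i y)" for x y
    unfolding L(2) sum_list_sum_nth by (rule sum.cong) auto
  ultimately show ?thesis
    by (intro exI[of _ "length L"] exI[of _ ?\<phi>]) blast
qed

text \<open>With \<open>A l\<close> the sum of a feature over the points and \<open>B l\<close> its
  spherical mean, the claim is that the squares of \<open>A l - card I * B l\<close> have a
  nonnegative sum. The sums involving \<open>B\<close> collapse because the kernel has the same mean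
  \<open>cap_moment d k\<close> around every point.\<close>

lemma sum_half_cos_power_ge:
  fixes x :: "'i \<Rightarrow> 'a::euclidean_space"
  assumes x: "\<And>i. i \<in> I \<Longrightarrow> norm (x i) = 1" and d: "d = real DIM('a) - 1" "d > 0"
  shows "(\<Sum>i\<in>I. \<Sum>j\<in>I. half_cos (x i) (x j) ^ k) \<ge> (real (card I))\<^sup>2 * cap_moment d k"
proof -
  let ?S = "sphere_vol :: 'a measure"
  define V where "V = measure ?S unit_sphere"
  have V: "V > 0" unfolding V_def by (rule measure_sphere_vol_pos)
  obtain n and \<phi> :: "nat \<Rightarrow> 'a \<Rightarrow> real" where cont: "\<And>l. continuous_on UNIV (\<phi> l)"
    and \<phi>: "\<And>x y. half_cos x y ^ k = (\<Sum>l<n. \<phi> l x * \<phi> l y)"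
    using half_cos_power_feature_expansion[of k] by blast
  have int: "integrable ?S (\<phi> l)" for l by (rule integrable_sphere_vol_continuous[OF cont])
  define A B where "A = (\<lambda>l. \<Sum>i\<in>I. \<phi> l (x i))" and "B = (\<lambda>l. (LINT y|?S. \<phi> l y) / V)"
  have \<phi>B: "(\<Sum>l<n. \<phi> l y * B l) = cap_moment d k" if "norm y = 1" for y
  proof -
    have "(\<Sum>l<n. \<phi> l y * B l) = (\<Sum>l<n. LINT z|?S. \<phi> l y * \<phi> l z) / V"
      by (simp add: B_def sum_divide_distrib)
    also have "\<dots> = (LINT z|?S. half_cos y z ^ k) / V"
      unfolding \<phi> by (subst Bochner_Integration.integral_sum) (auto intro: int)
    finally show ?thesis
      using V by (simp add: integral_half_cos_power[OF that d] V_def)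
  qed
  have AA: "(\<Sum>l<n. A l * A l) = (\<Sum>i\<in>I. \<Sum>j\<in>I. half_cos (x i) (x j) ^ k)"
    unfolding A_def \<phi> sum_product by (subst sum.swap) (intro sum.cong refl sum.swap)
  have AB: "(\<Sum>l<n. A l * B l) = card I * cap_moment d k"
  proof -
    have "(\<Sum>l<n. A l * B l) = (\<Sum>i\<in>I. \<Sum>l<n. \<phi> l (x i) * B l)"
      unfolding A_def sum_distrib_right by (rule sum.swap)
    also have "\<dots> = (\<Sum>i\<in>I. cap_moment d k)"
      by (intro sum.cong refl \<phi>B x)
    finally show ?thesis by simp
  qed
  have BB: "(\<Sum>l<n. B l * B l) = cap_moment d k"
  proof -
    have "(\<Sum>l<n. B l * B l) = (\<Sum>l<n. LINT z|?S. \<phi> l z * B l) / V"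
      by (simp add: B_def sum_divide_distrib)
    also have "\<dots> = (LINT z|?S. (\<Sum>l<n. \<phi> l z * B l)) / V"
      by (subst Bochner_Integration.integral_sum) (auto intro: int)
    also have "(LINT z|?S. (\<Sum>l<n. \<phi> l z * B l)) = (LINT z|?S. cap_moment d k)"
      by (rule Bochner_Integration.integral_cong) (auto simp: \<phi>B)
    finally show ?thesis using V by (simp add: V_def)
  qed
  have "0 \<le> (\<Sum>l<n. (A l - card I * B l)\<^sup>2)" by (rule sum_nonneg) simp
  also have "\<dots> = (\<Sum>l<n. A l * A l) - 2 * card I * (\<Sum>l<n. A l * B l) + (card I)\<^sup>2 * (\<Sum>l<n. B l * B l)"
    by (simp add: power2_eq_square algebra_simps sum.distrib sum_subtractf sum_distrib_left)
  finally show ?thesis unfolding AA AB BB by (simp add: power2_eq_square algebra_simps)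
qed

section \<open>Series expansion of the Green kernel\<close>

text \<open>The Green equation tested with \<open>half_cos p y ^ n\<close> as a function of
  \<open>y\<close>, whose Laplacian is the bracket in the integrand.\<close>

lemma green_kernel_half_cos_power:
  fixes G :: "'a::euclidean_space \<Rightarrow> 'a \<Rightarrow> ereal"
  assumes G: "green_kernel G" and d: "d = real DIM('a) - 1" "d > 0" and x: "norm x = 1" and p: "norm p = 1"
  shows "(LINT y|sphere_vol. real_of_ereal (G x y) * (real n * (real n + d - 1) * half_cos p y ^ n - real n * (real n - 1 + d / 2) * half_cos p y ^ (n - 1)))
     = half_cos x p ^ n - cap_moment d n"
proof -
  let ?\<phi> = "\<lambda>y. ((1 + p \<bullet> y) / 2) ^ n"
  have "(LINT y|sphere_vol. real_of_ereal (G x y) * sphere_laplacian ?\<phi> y)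
          = ?\<phi> x - (LINT y|sphere_vol. ?\<phi> y) / measure sphere_vol (unit_sphere :: 'a set)"
  proof -
    have "x \<in> unit_sphere" using x by simp
    then show ?thesis using G smooth_on_ridge_power[of unit_sphere p n] unfolding green_kernel_def by blast
  qed
  also have "(LINT y|sphere_vol. ?\<phi> y) = measure sphere_vol (unit_sphere :: 'a set) * cap_moment d n"
    using integral_half_cos_power[OF p d] by (simp add: half_cos_def)
  also have "(LINT y|sphere_vol. real_of_ereal (G x y) * sphere_laplacian ?\<phi> y) = 
     (LINT y|sphere_vol. real_of_ereal (G x y) * (real n * (real n + d - 1) * half_cos p y ^ n - real n * (real n - 1 + d / 2) * half_cos p y ^ (n - 1)))"
    by (rule Bochner_Integration.integral_cong) (use sphere_laplacian_ridge_power[OF p _ d(1), of _ n] in \<open>auto simp: half_cos_def\<close>)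
  finally show ?thesis
    using measure_sphere_vol_pos[where 'a='a] by (simp add: half_cos_def inner_commute)
qed

lemma integrable_mult_half_cos_power:
  fixes f :: "'a::euclidean_space \<Rightarrow> real"
  assumes f: "integrable sphere_vol f" and p: "norm p = 1"
  shows "integrable sphere_vol (\<lambda>y. f y * half_cos p y ^ n)"
proof (rule Bochner_Integration.integrable_bound[OF f])
  have "(\<lambda>y. half_cos p y ^ n) \<in> borel_measurable sphere_vol"
    by (intro borel_measurable_integrable integrable_sphere_vol_continuous continuous_intros)
  then show "(\<lambda>y. f y * half_cos p y ^ n) \<in> borel_measurable sphere_vol"
    using borel_measurable_integrable[OF f] by (rule borel_measurable_times[rotated])
  show "AE y in sphere_vol. norm (f y * half_cos p y ^ n) \<le> norm (f y)"
    using half_cos_bounds[OF p] by (intro AE_I2) (auto simp: abs_mult intro!: mult_right_le_one_le power_le_one)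
qed

text \<open>The moment recursion makes the two coefficients of the Laplacian agree after division by the
  moments, so the recursion in \<open>n\<close> becomes a telescoping sum.\<close>

lemma green_kernel_cap_average:
  fixes G :: "'a::euclidean_space \<Rightarrow> 'a \<Rightarrow> ereal"
  assumes G: "green_kernel G" and d: "d = real DIM('a) - 1" "d > 0" and x: "norm x = 1" and p: "norm p = 1"
  shows "(LINT y|sphere_vol. real_of_ereal (G x y) * half_cos p y ^ n) / cap_moment d n
     = (\<Sum>k=1..n. (half_cos x p ^ k / cap_moment d k - 1) / (k * (k + d - 1)))"
proof (induction n)
  case 0
  then show ?case using G x by (simp add: green_kernel_def)
next
  case (Suc m)
  define I where "I = (\<lambda>n. LINT y|sphere_vol. real_of_ereal (G x y) * half_cos p y ^ n)"
  define c where "c = cap_moment d (Suc m)"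
  have c: "c > 0" using cap_moment_pos[OF d(2)] by (simp add: c_def)
  have g: "integrable sphere_vol (\<lambda>y. real_of_ereal (G x y))"
    using G x by (simp add: green_kernel_def)
  define a b where "a = (m + 1) * (m + d)" and "b = (m + 1) * (m + d / 2)"
  have a: "a > 0" and b: "b > 0" using d(2) by (auto simp: a_def b_def add_nonneg_pos)
  have "half_cos x p ^ Suc m - c = (LINT y|sphere_vol. real_of_ereal (G x y) * (a * half_cos p y ^ Suc m - b * half_cos p y ^ m))"
    using green_kernel_half_cos_power[OF G d x p, of "Suc m"] by (simp add: a_def b_def c_def add.commute)
  also have "\<dots> = (LINT y|sphere_vol. a * (real_of_ereal (G x y) * half_cos p y ^ Suc m) - b * (real_of_ereal (G x y) * half_cos p y ^ m))"
    by (simp add: algebra_simps)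
  also have "\<dots> = a * I (Suc m) - b * I m"
    unfolding I_def using integrable_mult_half_cos_power[OF g p] by (simp del: power_Suc)
  finally have eq: "half_cos x p ^ Suc m - c = a * I (Suc m) - b * I m" .
  have "cap_moment d m * b = a * c"
    using d(2) by (simp add: a_def b_def c_def cap_moment_Suc)
  then have "b = a * c / cap_moment d m"
    using cap_moment_pos[OF d(2), of m] by (simp add: eq_divide_eq mult.commute)
  then have "b * I m = a * c * (I m / cap_moment d m)" by simp
  then have "half_cos x p ^ Suc m - c = a * c * (I (Suc m) / c - I m / cap_moment d m)"
    using eq c by (simp add: right_diff_distrib)
  then have "I (Suc m) / c = I m / cap_moment d m + (half_cos x p ^ Suc m - c) / c / a"
    using a c by simp
  also have "(half_cos x p ^ Suc m - c) / c / a = (half_cos x p ^ Suc m / c - 1) / a"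
    using c by (simp add: diff_divide_distrib)
  finally show ?case
    using Suc.IH by (simp add: I_def c_def a_def add.commute)
qed

lemma green_kernelD:
  fixes G :: "'a::euclidean_space \<Rightarrow> 'a \<Rightarrow> ereal"
  assumes "green_kernel G" "norm x = 1"
  shows "G x x = \<infinity>"
    and "norm y = 1 \<Longrightarrow> G x y = G y x"
    and "norm y = 1 \<Longrightarrow> x \<noteq> y \<Longrightarrow> \<bar>G x y\<bar> \<noteq> \<infinity>"
    and "integrable sphere_vol (\<lambda>y. real_of_ereal (G x y))"
    and "(LINT y|sphere_vol. real_of_ereal (G x y)) = 0"
  using assms unfolding green_kernel_def by auto

section \<open>From cap averages to values of the kernel off the diagonal\<close>

lemma green_kernel_continuous:
  fixes G :: "'a::euclidean_space \<Rightarrow> 'a \<Rightarrow> ereal"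
  assumes G: "green_kernel G" and x: "norm x = 1" and p: "norm p = 1" and "x \<noteq> p" and "e > 0"
  obtains \<delta> where "\<delta> > 0"
    "\<And>y. norm y = 1 \<Longrightarrow> dist y p < \<delta> \<Longrightarrow> \<bar>real_of_ereal (G x y) - real_of_ereal (G x p)\<bar> < e"
proof -
  let ?A = "{(x, y). x \<in> unit_sphere \<and> y \<in> unit_sphere \<and> x \<noteq> y} :: ('a \<times> 'a) set"
  let ?g = "\<lambda>(x, y). real_of_ereal (G x y)"
  have sm: "smooth_on ?A ?g" using G unfolding green_kernel_def by (elim conjE)
  have mem: "(x, p) \<in> ?A" using x p \<open>x \<noteq> p\<close> by simp
  obtain U F where U: "open U" "(x, p) \<in> U" "\<forall>k. Ck_on k F U" and F': "\<forall>y\<in>U \<inter> ?A. F y = ?g y"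
    using bspec[OF sm[unfolded smooth_on_def] mem] by (elim exE conjE)
  note F = bspec[OF F']
  have "continuous_on U F" using U(3)[rule_format, of 0] by simp
  then have "isCont F (x, p)" using U by (simp add: continuous_on_eq_continuous_at)
  then obtain r where r: "r > 0" "\<And>y. dist y (x, p) < r \<Longrightarrow> dist (F y) (F (x, p)) < e"
    using \<open>e > 0\<close> unfolding continuous_at_eps_delta by blast
  obtain s where s: "s > 0" "ball (x, p) s \<subseteq> U"
    using U by (meson open_contains_ball)
  \<comment> \<open>Capping the radius by \<open>dist x p\<close> keeps \<open>y\<close> different
    from \<open>x\<close>, and \<open>s\<close> keeps the pair in \<open>U\<close>, so
    \<open>F\<close> agrees with the kernel there.\<close>
  show ?thesis
  proof (rule that[of "min (min r s) (dist x p)"])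
    show "0 < min (min r s) (dist x p)" using r s \<open>x \<noteq> p\<close> by simp
    fix y assume y: "norm y = 1" "dist y p < min (min r s) (dist x p)"
    then have "x \<noteq> y" by auto
    have "dist (x, y) (x, p) = dist y p" by (simp add: dist_Pair_Pair)
    then have "dist (x, y) (x, p) < r" "dist (x, y) (x, p) < s" using y by simp_all
    then have "dist (F (x, y)) (F (x, p)) < e" "(x, y) \<in> U"
      using r(2) s(2) by (auto simp: dist_commute[of _ "(x, y)"] subset_iff mem_ball)
    then show "\<bar>real_of_ereal (G x y) - real_of_ereal (G x p)\<bar> < e"
      using F[of "(x, y)"] F[of "(x, p)"] U x p y \<open>x \<noteq> y\<close> \<open>x \<noteq> p\<close> by (simp add: dist_real_def)
  qed
qed

lemma dist_sphere_half_cos: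
  assumes "norm p = 1" "norm y = 1"
  shows "(dist y p)\<^sup>2 = 4 * (1 - half_cos p y)"
  using assms unfolding dist_norm power2_norm_eq_inner half_cos_def
  by (simp add: inner_simps norm_eq_1 inner_commute field_simps)

lemma power_times_powr_tendsto_0:
  fixes q a :: real
  assumes "0 < q" "q < 1"
  shows "(\<lambda>n. q ^ n * (real n + 1) powr a) \<longlonglongrightarrow> 0"
  using assms by real_asymp

text \<open>The densities \<open>half_cos p y ^ n / cap_moment d n\<close> have constant mass and
  concentrate at \<open>p\<close>: away from \<open>p\<close> the numerator decays exponentially,
  the moment only polynomially.\<close>

lemma cap_average_tendsto:
  fixes f :: "'a::euclidean_space \<Rightarrow> real"
  assumes f: "integrable sphere_vol f" and d: "d = real DIM('a) - 1" "d \<ge> 2" and p: "norm p = 1"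
    and cont: "\<And>e. e > 0 \<Longrightarrow> \<exists>\<delta>>0. \<forall>y. norm y = 1 \<longrightarrow> dist y p < \<delta> \<longrightarrow> \<bar>f y - c\<bar> < e"
  shows "(\<lambda>n. (LINT y|sphere_vol. f y * half_cos p y ^ n) / cap_moment d n)
     \<longlonglongrightarrow> measure sphere_vol (unit_sphere :: 'a set) * c"
proof -
  let ?S = "sphere_vol :: 'a measure"
  define V where "V = measure ?S unit_sphere"
  have V: "V > 0" unfolding V_def by (rule measure_sphere_vol_pos)
  have d0: "d > 0" using d(2) by simp
  note mu = cap_moment_pos[OF d0]
  let ?a = "\<lambda>n. (LINT y|?S. f y * half_cos p y ^ n) / cap_moment d n"
  interpret finite_measure ?S by (rule finite_measure_sphere_vol)
  have inth: "integrable ?S (\<lambda>y. half_cos p y ^ n)" for n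
    by (intro integrable_sphere_vol_continuous continuous_intros)
  have intf: "integrable ?S (\<lambda>y. f y * half_cos p y ^ n)" for n
    by (rule integrable_mult_half_cos_power[OF f p])
  have "\<exists>n0. \<forall>n\<ge>n0. \<bar>?a n - V * c\<bar> < e'" if e': "e' > 0" for e'
  proof -
    \<comment> \<open>The region near \<open>p\<close> contributes at most \<open>e\<close> times
      the total mass \<open>V\<close>, half of the allowed error.\<close>
    define e where "e = e' / (2 * V)"
    have e: "e > 0" "e * V = e' / 2" using e' V by (auto simp: e_def)
    obtain \<delta> where \<delta>: "\<delta> > 0" "\<And>y. norm y = 1 \<Longrightarrow> dist y p < \<delta> \<Longrightarrow> \<bar>f y - c\<bar> < e"
      using cont[OF e(1)] by blast
    \<comment> \<open>\<open>1 - \<delta>\<^sup>2 / 4\<close> bounds \<open>half_cos p y\<close> at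
      distance at least \<open>\<delta>\<close>; the maximum keeps \<open>q\<close> positive when
      \<open>\<delta>\<close> is large.\<close>
    define q where "q = max (1 / 2) (1 - \<delta>\<^sup>2 / 4)"
    have q: "0 < q" "q < 1" using \<delta> by (auto simp: q_def)
    define K where "K = (LINT y|?S. \<bar>f y\<bar> + \<bar>c\<bar>)"
    have intK: "integrable ?S (\<lambda>y. \<bar>f y\<bar> + \<bar>c\<bar>)" using f by simp
    have bound: "\<bar>?a n - V * c\<bar> \<le> e' / 2 + K * (q ^ n * (real n + 1) powr (d / 2))" for n
    proof -
      have pt: "\<bar>f y - c\<bar> * half_cos p y ^ n \<le> e * half_cos p y ^ n + q ^ n * (\<bar>f y\<bar> + \<bar>c\<bar>)" if y: "norm y = 1" for y
      proof (cases "dist y p < \<delta>")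
        case True
        have "\<bar>f y - c\<bar> * half_cos p y ^ n \<le> e * half_cos p y ^ n"
          using \<delta>(2)[OF y True] half_cos_bounds[OF p y] by (intro mult_right_mono) auto
        moreover have "0 \<le> q ^ n * (\<bar>f y\<bar> + \<bar>c\<bar>)" using q by (intro mult_nonneg_nonneg) auto
        ultimately show ?thesis by linarith
      next
        case False
        then have "\<delta>\<^sup>2 \<le> (dist y p)\<^sup>2" using \<delta>(1) by (intro power_mono) auto
        then have "half_cos p y \<le> q" unfolding dist_sphere_half_cos[OF p y] q_def by simp
        then have "half_cos p y ^ n \<le> q ^ n" using half_cos_bounds[OF p y] by (intro power_mono) auto
        then have "\<bar>f y - c\<bar> * half_cos p y ^ n \<le> (\<bar>f y\<bar> + \<bar>c\<bar>) * q ^ n"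
          using half_cos_bounds[OF p y] by (intro mult_mono) auto
        moreover have "0 \<le> e * half_cos p y ^ n" using e half_cos_bounds[OF p y] by simp
        ultimately show ?thesis by (simp add: mult.commute)
      qed
      have inta: "integrable ?S (\<lambda>y. \<bar>f y - c\<bar> * half_cos p y ^ n)"
        by (intro integrable_mult_half_cos_power p integrable_abs Bochner_Integration.integrable_diff f) simp
      have "?a n - V * c = ((LINT y|?S. f y * half_cos p y ^ n) - c * (LINT y|?S. half_cos p y ^ n)) / cap_moment d n"
        using mu[of n] by (simp add: integral_half_cos_power[OF p d(1) d0] V_def diff_divide_distrib)
      also have "(LINT y|?S. f y * half_cos p y ^ n) - c * (LINT y|?S. half_cos p y ^ n) = (LINT y|?S. (f y - c) * half_cos p y ^ n)"
        using intf inth by (simp add: left_diff_distrib)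
      finally have "\<bar>?a n - V * c\<bar> = \<bar>LINT y|?S. (f y - c) * half_cos p y ^ n\<bar> / cap_moment d n"
        using mu[of n] by (simp add: abs_divide)
      also have "\<dots> \<le> (LINT y|?S. \<bar>(f y - c) * half_cos p y ^ n\<bar>) / cap_moment d n"
        using mu[of n] by (intro divide_right_mono integral_abs_bound) auto
      also have "(LINT y|?S. \<bar>(f y - c) * half_cos p y ^ n\<bar>) = (LINT y|?S. \<bar>f y - c\<bar> * half_cos p y ^ n)"
        by (rule Bochner_Integration.integral_cong) (use half_cos_bounds[OF p] in \<open>auto simp: abs_mult\<close>)
      also have "(LINT y|?S. \<bar>f y - c\<bar> * half_cos p y ^ n) / cap_moment d n
         \<le> (LINT y|?S. e * half_cos p y ^ n + q ^ n * (\<bar>f y\<bar> + \<bar>c\<bar>)) / cap_moment d n"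
        using inth intK mu[of n] by (intro divide_right_mono integral_mono inta) (auto intro: pt simp: less_imp_le)
      also have "(LINT y|?S. e * half_cos p y ^ n + q ^ n * (\<bar>f y\<bar> + \<bar>c\<bar>)) = e * (V * cap_moment d n) + q ^ n * K"
        using inth intK by (simp add: integral_half_cos_power[OF p d(1) d0] V_def K_def)
      also have "(e * (V * cap_moment d n) + q ^ n * K) / cap_moment d n = e * V + K * (q ^ n * (1 / cap_moment d n))"
        using mu[of n] by (simp add: field_simps)
      also have "\<dots> \<le> e * V + K * (q ^ n * (real n + 1) powr (d / 2))"
      proof -
        have "0 \<le> K" unfolding K_def by (intro integral_nonneg_AE) auto
        then show ?thesis using q
          by (intro add_left_mono mult_left_mono inverse_cap_moment_le[OF d(2)]) auto
      qed
      finally show ?thesis using e by simp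
    qed
    have "(\<lambda>n. e' / 2 + K * (q ^ n * (real n + 1) powr (d / 2))) \<longlonglongrightarrow> e' / 2 + K * 0"
      by (intro tendsto_intros power_times_powr_tendsto_0 q)
    then have "\<forall>\<^sub>F n in sequentially. e' / 2 + K * (q ^ n * (real n + 1) powr (d / 2)) < e'"
      by (rule order_tendstoD) (use e' in simp)
    then obtain n0 where "\<And>n. n \<ge> n0 \<Longrightarrow> e' / 2 + K * (q ^ n * (real n + 1) powr (d / 2)) < e'"
      by (auto simp: eventually_sequentially)
    then show ?thesis using bound by (intro exI[of _ n0]) (meson le_less_trans)
  qed
  then show ?thesis
    unfolding V_def[symmetric] LIMSEQ_def dist_real_def by blast
qed

text \<open>For \<open>k \<ge> 2\<close> the \<open>k\<close>-th term is at least
  \<open>- 1 / (k * (k + d - 1))\<close>, hence at least \<open>1 / k - 1 / (k - 1)\<close>. So the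
  partial sum minus \<open>1 / n\<close> is nondecreasing in \<open>n\<close>, and the partial sums
  converge to the kernel.\<close>

lemma green_kernel_ge_partial_sum:
  fixes G :: "'a::euclidean_space \<Rightarrow> 'a \<Rightarrow> ereal"
  assumes G: "green_kernel G" and d: "d = real DIM('a) - 1" "d \<ge> 2"
    and x: "norm x = 1" and p: "norm p = 1" and "x \<noteq> p" and m: "m \<ge> 1"
  shows "(\<Sum>k=1..m. (half_cos x p ^ k / cap_moment d k - 1) / (k * (k + d - 1))) - 1 / m
     \<le> measure sphere_vol (unit_sphere :: 'a set) * real_of_ereal (G x p)"
proof -
  have d0: "d > 0" using d(2) by simp
  let ?s = "\<lambda>n. \<Sum>k=1..n. (half_cos x p ^ k / cap_moment d k - 1) / (k * (k + d - 1))"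
  have lim: "?s \<longlonglongrightarrow> measure sphere_vol (unit_sphere :: 'a set) * real_of_ereal (G x p)"
    unfolding green_kernel_cap_average[OF G d(1) d0 x p, symmetric]
  proof (rule cap_average_tendsto[OF _ d p])
    show "\<exists>\<delta>>0. \<forall>y. norm y = 1 \<longrightarrow> dist y p < \<delta> \<longrightarrow> \<bar>real_of_ereal (G x y) - real_of_ereal (G x p)\<bar> < e" if "e > 0" for e
      using green_kernel_continuous[OF G x p \<open>x \<noteq> p\<close> that] by metis
  qed (rule green_kernelD(4)[OF G x])
  have step: "?s m - 1 / m \<le> ?s n - 1 / n" if "m \<le> n" for n
    using that
  proof (induction n rule: dec_induct)
    case (step n)
    let ?h = "half_cos x p ^ Suc n / cap_moment d (Suc n)"
    have n: "real n \<ge> 1" using step m by simp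
    have "?h \<ge> 0"
      using half_cos_bounds[OF x p] cap_moment_pos[OF d0, of "Suc n"] by simp
    then have "(?h - 1) / (Suc n * (Suc n + d - 1)) \<ge> - 1 / (Suc n * (Suc n + d - 1))"
      using d n by (intro divide_right_mono) auto
    moreover have "1 / (Suc n * (Suc n + d - 1)) \<le> 1 / (real (Suc n) * real n)"
    proof (rule divide_left_mono)
      show "real (Suc n) * real n \<le> Suc n * (Suc n + d - 1)"
        using d(2) by (intro mult_left_mono) (simp_all del: d(1))
      moreover have "real (Suc n) * real n > 0" using n by simp
      ultimately show "0 < Suc n * (Suc n + d - 1) * (real (Suc n) * real n)"
        by (intro mult_pos_pos[of _ "real (Suc n) * real n"]) linarith+
    qed simp
    moreover have "1 / (real (Suc n) * real n) = 1 / n - 1 / Suc n"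
      using n by (simp add: field_simps)
    ultimately have "(?h - 1) / (Suc n * (Suc n + d - 1)) \<ge> 1 / Suc n - 1 / n"
      by (simp only: minus_divide_left[symmetric])
    moreover have "?s (Suc n) = ?s n + (?h - 1) / (Suc n * (Suc n + d - 1))"
      by (simp del: of_nat_Suc power_Suc)
    ultimately show ?case using step.IH by linarith
  qed simp
  have "\<exists>N. \<forall>n\<ge>N. ?s m - 1 / m \<le> ?s n"
  proof (intro exI allI impI)
    fix n assume "m \<le> n"
    from step[OF this] show "?s m - 1 / m \<le> ?s n"
      using divide_nonneg_nonneg[of 1 "real n"] by linarith
  qed
  with lim show ?thesis by (rule LIMSEQ_le_const)
qed

text \<open>The truncated kernel has a nonnegative full double sum, so dropping the diagonal costs
  at most its \<open>card I\<close> entries, bounded by \<open>sum_reciprocal_cap_moment\<close>;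
  each pair loses a further \<open>1 / m\<close>. The free \<open>m\<close> is for balancing the two
  losses.\<close>

lemma green_energy_ge:
  fixes G :: "'a::euclidean_space \<Rightarrow> 'a \<Rightarrow> ereal" and x :: "'i \<Rightarrow> 'a"
  assumes G: "green_kernel G" and d: "d = real DIM('a) - 1" "d \<ge> 3"
    and I: "finite I" "inj_on x I" "\<And>i. i \<in> I \<Longrightarrow> norm (x i) = 1" and m: "m \<ge> 1"
  shows "- (card I * (4 / ((real m + 2) * cap_moment d m)) + (card I)\<^sup>2 / m)
    \<le> measure sphere_vol (unit_sphere :: 'a set) * (\<Sum>i\<in>I. \<Sum>j\<in>I - {i}. real_of_ereal (G (x i) (x j)))"
proof -
  define V where "V = measure sphere_vol (unit_sphere :: 'a set)"
  define s where "s = (\<lambda>z. \<Sum>k=1..m. (z ^ k / cap_moment d k - 1) / (k * (k + d - 1)))"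
  define N where "N = real (card I)"
  have d0: "d > 0" using d by simp
  have diag: "s (half_cos (x i) (x i)) \<le> 4 / ((real m + 2) * cap_moment d m)" if "i \<in> I" for i
  proof -
    have "half_cos (x i) (x i) = 1" using I(3)[OF that] by (simp add: half_cos_def norm_eq_1)
    then have "s (half_cos (x i) (x i)) \<le> (\<Sum>k=1..m. 1 / (k * (k + d - 1) * cap_moment d k))"
      unfolding s_def
    proof (intro sum_mono)
      fix k assume "half_cos (x i) (x i) = 1" "k \<in> {1..m}"
      then have "real k * (k + d - 1) \<ge> 0" using d by simp
      then have "(1 / cap_moment d k - 1) / (k * (k + d - 1)) \<le> (1 / cap_moment d k) / (k * (k + d - 1))"
        by (intro divide_right_mono) auto
      then show "(half_cos (x i) (x i) ^ k / cap_moment d k - 1) / (k * (k + d - 1)) \<le> 1 / (k * (k + d - 1) * cap_moment d k)"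
        using \<open>half_cos (x i) (x i) = 1\<close> by (simp add: mult.commute)
    qed
    also have "\<dots> \<le> 4 / ((real m + 2) * cap_moment d m)" using sum_reciprocal_cap_moment[OF d(2), of m] by (simp only: of_nat_add of_nat_numeral)
    finally show ?thesis .
  qed
  have pd: "(\<Sum>i\<in>I. \<Sum>j\<in>I. s (half_cos (x i) (x j))) \<ge> 0"
  proof -
    have "(\<Sum>i\<in>I. \<Sum>j\<in>I. s (half_cos (x i) (x j))) 
       = (\<Sum>k=1..m. \<Sum>i\<in>I. \<Sum>j\<in>I. (half_cos (x i) (x j) ^ k / cap_moment d k - 1) / (k * (k + d - 1)))"
      unfolding s_def by (subst (2) sum.swap, subst (1) sum.swap) (rule refl)
    also have "\<dots> = (\<Sum>k=1..m. ((\<Sum>i\<in>I. \<Sum>j\<in>I. half_cos (x i) (x j) ^ k) / cap_moment d k - N\<^sup>2) / (k * (k + d - 1)))"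
      by (simp add: sum_divide_distrib[symmetric] sum_subtractf N_def power2_eq_square)
    also have "\<dots> \<ge> 0"
    proof (intro sum_nonneg divide_nonneg_nonneg)
      fix k assume k: "k \<in> {1..m}"
      show "0 \<le> real k * (k + d - 1)" using k d by simp
      show "0 \<le> (\<Sum>i\<in>I. \<Sum>j\<in>I. half_cos (x i) (x j) ^ k) / cap_moment d k - N\<^sup>2"
        using sum_half_cos_power_ge[of I x d k, OF I(3) d(1) d0] cap_moment_pos[OF d0, of k]
        by (simp add: N_def le_divide_eq)
    qed
    finally show ?thesis .
  qed
  have "(\<Sum>i\<in>I. \<Sum>j\<in>I - {i}. s (half_cos (x i) (x j)) - 1 / m) \<le> (\<Sum>i\<in>I. \<Sum>j\<in>I - {i}. V * real_of_ereal (G (x i) (x j)))"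
    unfolding s_def V_def
  proof (intro sum_mono)
    fix i j assume ij: "i \<in> I" "j \<in> I - {i}"
    then have "x i \<noteq> x j" using I(2) by (auto dest: inj_onD)
    then show "(\<Sum>k=1..m. (half_cos (x i) (x j) ^ k / cap_moment d k - 1) / (k * (k + d - 1))) - 1 / m
       \<le> measure sphere_vol (unit_sphere :: 'a set) * real_of_ereal (G (x i) (x j))"
      using ij I(3) d m by (intro green_kernel_ge_partial_sum[OF G]) auto
  qed
  moreover have "(\<Sum>i\<in>I. \<Sum>j\<in>I - {i}. s (half_cos (x i) (x j)) - 1 / m) \<ge> - (N * (4 / ((real m + 2) * cap_moment d m)) + N\<^sup>2 / m)"
  proof -
    have "(\<Sum>j\<in>I - {i}. s (half_cos (x i) (x j)) - 1 / m) \<ge> (\<Sum>j\<in>I. s (half_cos (x i) (x j))) - 4 / ((real m + 2) * cap_moment d m) - N / m"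
      if i: "i \<in> I" for i
    proof -
      have "(\<Sum>j\<in>I - {i}. s (half_cos (x i) (x j)) - 1 / m) 
         = (\<Sum>j\<in>I. s (half_cos (x i) (x j)) - 1 / m) - (s (half_cos (x i) (x i)) - 1 / m)"
        using I(1) i by (simp add: sum_diff1)
      also have "\<dots> \<ge> (\<Sum>j\<in>I. s (half_cos (x i) (x j))) - N / m - 4 / ((real m + 2) * cap_moment d m)"
      proof -
        have "(\<Sum>j\<in>I. s (half_cos (x i) (x j)) - 1 / m) = (\<Sum>j\<in>I. s (half_cos (x i) (x j))) - N / m"
          by (simp add: sum_subtractf N_def)
        moreover have "1 / real m \<ge> 0" by simp
        ultimately show ?thesis using diag[OF i] by linarith
      qed
      finally show ?thesis by linarith
    qed
    then have "(\<Sum>i\<in>I. \<Sum>j\<in>I - {i}. s (half_cos (x i) (x j)) - 1 / m)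
       \<ge> (\<Sum>i\<in>I. (\<Sum>j\<in>I. s (half_cos (x i) (x j))) - 4 / ((real m + 2) * cap_moment d m) - N / m)"
      by (rule sum_mono)
    then show ?thesis using pd
      by (simp add: sum_subtractf N_def power2_eq_square)
  qed
  ultimately show ?thesis
    by (simp add: N_def V_def sum_distrib_left)
qed

section \<open>Minima of potentials\<close>

text \<open>The indicator of a point \<open>p\<close> lies below every power of
  \<open>half_cos p\<close>, and the moments tend to \<open>0\<close>, so points are null
  sets.\<close>

lemma AE_sphere_vol_not_finite:
  fixes A :: "'a::euclidean_space set"
  assumes A: "finite A" "A \<subseteq> unit_sphere" and d: "real DIM('a) - 1 \<ge> 2"
  shows "AE y in sphere_vol. y \<notin> A"
proof -
  let ?S = "sphere_vol :: 'a measure"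
  let ?d = "real DIM('a) - 1"
  interpret finite_measure ?S by (rule finite_measure_sphere_vol)
  have d0: "?d > 0" using d by linarith
  have sets: "{p} \<in> sets ?S" if "p \<in> unit_sphere" for p
    unfolding sets_sphere_vol using that by (auto simp: sets_restrict_space)
  have null_measure: "measure ?S {p} \<le> 0" if p: "norm p = 1" for p :: 'a
  proof (rule LIMSEQ_le_const)
    have "(\<lambda>n. ((?d - 1) / (real n + ?d - 1)) powr (?d / 2)) \<longlonglongrightarrow> 0"
      using d by real_asymp
    from tendsto_mult[OF tendsto_const this]
    show "(\<lambda>n. measure ?S unit_sphere * ((?d - 1) / (real n + ?d - 1)) powr (?d / 2)) \<longlonglongrightarrow> 0" by simp
    show "\<exists>N. \<forall>n\<ge>N. measure ?S {p} \<le> measure ?S unit_sphere * ((?d - 1) / (real n + ?d - 1)) powr (?d / 2)"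
    proof (intro exI allI impI)
      fix n
      have "measure ?S {p} = (LINT y|?S. indicat_real {p} y)" using p by simp
      also have "\<dots> \<le> (LINT y|?S. half_cos p y ^ n)"
      proof (rule integral_mono)
        show "integrable ?S (indicat_real {p})"
          using sets[of p] p by (intro integrable_real_indicator) (auto simp: emeasure_eq_measure)
        show "integrable ?S (\<lambda>y. half_cos p y ^ n)"
          by (intro integrable_sphere_vol_continuous continuous_intros)
        show "indicat_real {p} y \<le> half_cos p y ^ n" if "y \<in> space ?S" for y
          using half_cos_bounds[OF p, of y] that p by (auto simp: indicator_def half_cos_def norm_eq_1)
      qed
      also have "\<dots> = measure ?S unit_sphere * cap_moment ?d n"
        by (rule integral_half_cos_power[OF p refl d0])
      also have "\<dots> \<le> measure ?S unit_sphere * ((?d - 1) / (real n + ?d - 1)) powr (?d / 2)"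
        by (intro mult_left_mono cap_moment_le d) simp
      finally show "measure ?S {p} \<le> measure ?S unit_sphere * ((?d - 1) / (real n + ?d - 1)) powr (?d / 2)" .
    qed
  qed
  have null: "AE y in ?S. y \<noteq> p" if "p \<in> A" for p
  proof (rule AE_I[where N="{p}"])
    have p: "norm p = 1" using that A(2) by auto
    then have "measure ?S {p} = 0" using null_measure[OF p] measure_nonneg[of ?S "{p}"] by linarith
    then show "emeasure ?S {p} = 0" by (simp add: emeasure_eq_measure)
    show "{p} \<in> sets ?S" using p sets by simp
  qed auto
  have "AE y in ?S. \<forall>p\<in>A. y \<noteq> p"
    using A(1) null by (intro AE_finite_allI) auto
  then show ?thesis by eventually_elim auto
qed

lemma measurable_half_cos_pair:
  "(\<lambda>(p, y). half_cos p y) \<in> borel_measurable (sphere_vol \<Otimes>\<^sub>M (sphere_vol :: 'a::euclidean_space measure))"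
proof -
  have id: "(\<lambda>y. y) \<in> borel_measurable (sphere_vol :: 'a measure)"
    by (rule measurable_sphere_vol_borel) simp
  have "(\<lambda>z. fst z) \<in> borel_measurable ((sphere_vol :: 'a measure) \<Otimes>\<^sub>M (sphere_vol :: 'a measure))"
    "(\<lambda>z. snd z) \<in> borel_measurable ((sphere_vol :: 'a measure) \<Otimes>\<^sub>M (sphere_vol :: 'a measure))"
    using measurable_compose[OF measurable_fst id, of "sphere_vol :: 'a measure"]
      measurable_compose[OF measurable_snd id, of "sphere_vol :: 'a measure"] by simp_all
  then show ?thesis
    unfolding half_cos_def case_prod_beta by (intro borel_measurable_divide borel_measurable_add borel_measurable_inner) auto
qed

text \<open>The double integral of \<open>\<bar>U y\<bar> * \<bar>\<Lambda> p y\<bar>\<close> is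
  estimated twice. Integrating in \<open>y\<close> first bounds it below by the integral of
  \<open>\<bar>\<nu> p - s\<bar>\<close>, at least \<open>s * V\<close>; integrating in
  \<open>p\<close> first bounds it above by \<open>b\<close> times the \<open>L1\<close> norm of
  \<open>U\<close>, at most \<open>- 2 * m * V * b\<close>.\<close>

lemma green_potential_min_le:
  fixes G :: "'a::euclidean_space \<Rightarrow> 'a \<Rightarrow> ereal" and x :: "'i \<Rightarrow> 'a"
  assumes G: "green_kernel G" and d: "d = real DIM('a) - 1" "d \<ge> 2"
    and I: "finite I" "I \<noteq> {}" "\<And>i. i \<in> I \<Longrightarrow> norm (x i) = 1"
    and k: "k \<ge> 1" "4 * real (card I) * (cap_moment d k)\<^sup>2 \<le> cap_moment d (2 * k)"
    and m: "\<And>y. norm y = 1 \<Longrightarrow> y \<notin> x ` I \<Longrightarrow> m \<le> (\<Sum>i\<in>I. real_of_ereal (G (x i) y))"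
  shows "m \<le> - (card I / (8 * measure sphere_vol (unit_sphere :: 'a set) * k * d))"
proof -
  let ?S = "sphere_vol :: 'a measure"
  interpret finite_measure ?S by (rule finite_measure_sphere_vol)
  interpret pair: pair_sigma_finite ?S ?S ..
  define V where "V = measure ?S unit_sphere"
  define N where "N = real (card I)"
  \<comment> \<open>The even exponent makes every bump in \<open>\<nu>\<close> the square of a bump
    of exponent \<open>k\<close>.\<close>
  define n where "n = 2 * k"
  define U where "U = (\<lambda>y. \<Sum>i\<in>I. real_of_ereal (G (x i) y))"
  define \<Lambda> :: "'a \<Rightarrow> 'a \<Rightarrow> real" where "\<Lambda> = (\<lambda>p y. real n * (real n + d - 1) * half_cos p y ^ n - real n * (real n - 1 + d / 2) * half_cos p y ^ (n - 1))"
  define \<nu> where "\<nu> = (\<lambda>p. \<Sum>i\<in>I. half_cos (x i) p ^ n)"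
  define s where "s = N * cap_moment d n"
  have d0: "d > 0" using d by simp
  note mu = cap_moment_pos[OF d0]
  have V: "V > 0" unfolding V_def by (rule measure_sphere_vol_pos)
  have N: "N \<ge> 1" using I by (simp add: N_def Suc_le_eq card_gt_0_iff)
  have n: "n \<ge> 2" using k by (simp add: n_def)
  have s: "s > 0" using N mu by (simp add: s_def)
  have intG: "integrable ?S (\<lambda>y. real_of_ereal (G (x i) y))" if "i \<in> I" for i
    by (rule green_kernelD(4)[OF G I(3)[OF that]])
  have intU: "integrable ?S U" unfolding U_def by (intro Bochner_Integration.integrable_sum intG)
  have U0: "(LINT y|?S. U y) = 0"
    unfolding U_def by (subst Bochner_Integration.integral_sum) (auto intro: intG simp: green_kernelD(5)[OF G I(3)])
  have mU: "AE y in ?S. m \<le> U y"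
  proof -
    have "AE y in ?S. y \<notin> x ` I" by (rule AE_sphere_vol_not_finite) (use I d in auto)
    moreover have "AE y in ?S. norm y = 1" by (intro AE_I2) simp
    ultimately show ?thesis by eventually_elim (simp add: m U_def)
  qed
  have m0: "m \<le> 0"
  proof -
    have "(LINT y|?S. m) \<le> (LINT y|?S. U y)" by (intro integral_mono_AE intU mU) simp
    then show ?thesis using V by (simp add: U0 V_def mult_le_0_iff)
  qed
  have absU: "(LINT y|?S. \<bar>U y\<bar>) \<le> - 2 * m * V"
  proof -
    \<comment> \<open>For either sign of \<open>U y\<close>, \<open>m \<le> U y\<close> and
      \<open>m \<le> 0\<close> give \<open>\<bar>U y\<bar> \<le> U y - 2 * m\<close>.\<close>
    have "(LINT y|?S. \<bar>U y\<bar>) \<le> (LINT y|?S. U y - 2 * m)"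
      using mU m0 intU by (intro integral_mono_AE) auto
    also have "\<dots> = - 2 * m * V" using intU by (simp add: U0 V_def)
    finally show ?thesis .
  qed
  have inth: "integrable ?S (\<lambda>y. half_cos p y ^ j)" for j p
    by (intro integrable_sphere_vol_continuous continuous_intros)
  have \<Lambda>int: "(LINT y|?S. U y * \<Lambda> p y) = \<nu> p - s" if p: "norm p = 1" for p
  proof -
    have "integrable ?S (\<lambda>y. real_of_ereal (G (x i) y) * \<Lambda> p y)" if "i \<in> I" for i
    proof -
      have "real_of_ereal (G (x i) y) * \<Lambda> p y = (real n * (real n + d - 1)) * (real_of_ereal (G (x i) y) * half_cos p y ^ n)
         - (real n * (real n - 1 + d / 2)) * (real_of_ereal (G (x i) y) * half_cos p y ^ (n - 1))" for y
        by (simp add: \<Lambda>_def algebra_simps)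
      then show ?thesis using integrable_mult_half_cos_power[OF intG[OF that] p] by simp
    qed
    then have "(LINT y|?S. U y * \<Lambda> p y) = (\<Sum>i\<in>I. (LINT y|?S. real_of_ereal (G (x i) y) * \<Lambda> p y))"
      unfolding U_def sum_distrib_right by (rule Bochner_Integration.integral_sum)
    also have "\<dots> = (\<Sum>i\<in>I. half_cos (x i) p ^ n - cap_moment d n)"
      unfolding \<Lambda>_def by (intro sum.cong refl green_kernel_half_cos_power[OF G d(1) d0] I(3) p)
    finally show ?thesis by (simp add: \<nu>_def s_def N_def sum_subtractf)
  qed
  \<comment> \<open>After factoring out \<open>n * half_cos y p ^ (n - 1)\<close>, the triangle
    inequality leaves two terms whose integrals coincide by the moment recursion. The bound is
    therefore linear in \<open>n\<close>, although the coefficients of \<open>\<Lambda>\<close> are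
    quadratic.\<close>
  have \<Lambda>abs: "(LINT p|?S. \<bar>\<Lambda> p y\<bar>) \<le> V * n * d * cap_moment d (n - 1)" if y: "norm y = 1" for y
  proof -
    let ?b = "\<lambda>p. n * ((d / 2) * half_cos y p ^ (n - 1) + (n + d - 1) * (half_cos y p ^ (n - 1) - half_cos y p ^ n))"
    have b: "\<bar>\<Lambda> p y\<bar> \<le> ?b p" if p: "norm p = 1" for p
    proof -
      let ?h = "half_cos y p"
      have h: "0 \<le> ?h" "?h \<le> 1" by (rule half_cos_bounds[OF y p])+
      have pw: "?h ^ n = ?h * ?h ^ (n - 1)" using n by (metis One_nat_def Suc_pred power_Suc zero_less_iff_neq_zero not_numeral_le_zero)
      have "\<Lambda> p y = (n * ?h ^ (n - 1)) * (d / 2 - (n + d - 1) * (1 - ?h))"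
        unfolding \<Lambda>_def half_cos_commute[of p y] pw using n by (simp add: algebra_simps)
      also have "\<bar>\<dots>\<bar> = (n * ?h ^ (n - 1)) * \<bar>d / 2 - (n + d - 1) * (1 - ?h)\<bar>"
        using h by (simp add: abs_mult)
      also have "\<dots> \<le> (n * ?h ^ (n - 1)) * (d / 2 + (n + d - 1) * (1 - ?h))"
      proof (rule mult_left_mono)
        have "(n + d - 1) * (1 - ?h) \<ge> 0" using n d h by (intro mult_nonneg_nonneg) auto
        then show "\<bar>d / 2 - (n + d - 1) * (1 - ?h)\<bar> \<le> d / 2 + (n + d - 1) * (1 - ?h)" using d0 by linarith
      qed (use h in simp)
      also have "\<dots> = ?b p" unfolding pw by (simp add: algebra_simps)
      finally show ?thesis .
    qed
    have "(LINT p|?S. \<bar>\<Lambda> p y\<bar>) \<le> (LINT p|?S. ?b p)"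
    proof (rule integral_mono)
      show "integrable ?S (\<lambda>p. \<bar>\<Lambda> p y\<bar>)"
        unfolding \<Lambda>_def half_cos_commute[of _ y] by (intro integrable_abs Bochner_Integration.integrable_diff integrable_mult_right inth)
      show "integrable ?S ?b" using inth by simp
    qed (use b in auto)
    also have "\<dots> = n * ((d / 2) * (V * cap_moment d (n - 1)) + ((n + d - 1) * (V * cap_moment d (n - 1)) - (n + d - 1) * (V * cap_moment d n)))"
      using inth by (simp add: integral_half_cos_power[OF y d(1) d0] V_def right_diff_distrib)
    also have "(n + d - 1) * (V * cap_moment d n) = V * cap_moment d (n - 1) * (n - 1 + d / 2)"
    proof -
      obtain j where j: "n = Suc j" using n by (cases n) auto
      have "j + d > 0" using d0 by simp
      then show ?thesis unfolding j by (simp add: cap_moment_Suc)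
    qed
    also have "n * ((d / 2) * (V * cap_moment d (n - 1)) + ((n + d - 1) * (V * cap_moment d (n - 1)) - V * cap_moment d (n - 1) * (n - 1 + d / 2)))
      = V * n * d * cap_moment d (n - 1)"
      using n by (simp add: of_nat_diff field_simps)
    finally show ?thesis .
  qed
  have int\<nu>: "integrable ?S (\<lambda>p. \<bar>\<nu> p - s\<bar>)"
    unfolding \<nu>_def by (intro integrable_sphere_vol_continuous continuous_intros)
  \<comment> \<open>Since \<open>\<bar>a - b\<bar> = a + b - 2 * min a b\<close> and both
    \<open>\<nu>\<close> and \<open>s\<close> have integral \<open>s * V\<close>, it suffices that
    the minimum has integral at most \<open>s * V / 2\<close>; the hypothesis on \<open>k\<close>
    gives this through the majorant \<open>sqrt s * T p\<close>.\<close>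
  have lower: "s * V \<le> (LINT p|?S. \<bar>\<nu> p - s\<bar>)"
  proof -
    define T where "T = (\<lambda>p. \<Sum>i\<in>I. half_cos (x i) p ^ k)"
    have intT: "integrable ?S T" unfolding T_def by (intro integrable_sphere_vol_continuous continuous_intros)
    have int\<nu>': "integrable ?S \<nu>" unfolding \<nu>_def by (intro integrable_sphere_vol_continuous continuous_intros)
    \<comment> \<open>\<open>min (\<nu> p) s \<le> sqrt s * T p\<close>, because \<open>\<nu> p \<le> (T p)\<^sup>2\<close>\<close>
    have pt: "\<nu> p + s - 2 * sqrt s * T p \<le> \<bar>\<nu> p - s\<bar>" if p: "norm p = 1" for p
    proof -
      have h: "0 \<le> half_cos (x i) p" if "i \<in> I" for i by (rule half_cos_bounds[OF I(3)[OF that] p])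
      have T0: "T p \<ge> 0" unfolding T_def by (intro sum_nonneg zero_le_power h)
      have "\<nu> p = (\<Sum>i\<in>I. half_cos (x i) p ^ k * half_cos (x i) p ^ k)"
        by (simp add: \<nu>_def n_def power_add[symmetric] mult_2)
      also have "\<dots> \<le> (\<Sum>i\<in>I. half_cos (x i) p ^ k * T p)"
        unfolding T_def using I(1) h by (intro sum_mono mult_left_mono member_le_sum) auto
      also have "\<dots> = T p * T p" by (simp add: T_def sum_distrib_right)
      finally have \<nu>T: "\<nu> p \<le> T p * T p" .
      have sq: "sqrt s * sqrt s = s" using s by simp
      show ?thesis
      proof (cases "T p \<le> sqrt s")
        case True
        then have "T p * T p \<le> sqrt s * T p" using T0 by (intro mult_right_mono)
        then show ?thesis using \<nu>T by linarith
      next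
        case False
        then have "sqrt s * sqrt s \<le> sqrt s * T p" using s by (intro mult_left_mono) auto
        then show ?thesis using sq by linarith
      qed
    qed
    have "(N * cap_moment d k)\<^sup>2 \<le> (sqrt s / 2)\<^sup>2"
    proof -
      have "4 * N * (cap_moment d k)\<^sup>2 * N \<le> cap_moment d n * N"
        using k(2) N by (intro mult_right_mono) (auto simp: N_def n_def)
      then show ?thesis using s by (simp add: s_def power2_eq_square power_divide mult_ac)
    qed
    then have "N * cap_moment d k \<le> sqrt s / 2"
      by (rule power2_le_imp_le) (use s in simp)
    then have "2 * sqrt s * (N * cap_moment d k) \<le> 2 * sqrt s * (sqrt s / 2)"
      using s by (intro mult_left_mono) auto
    then have le: "2 * sqrt s * (N * cap_moment d k) \<le> s" using s by simp
    have "(LINT p|?S. \<nu> p) = s * V"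
      unfolding \<nu>_def s_def N_def V_def
      by (subst Bochner_Integration.integral_sum) (auto intro: inth simp: integral_half_cos_power[OF I(3) d(1) d0])
    moreover have "(LINT p|?S. T p) = N * cap_moment d k * V"
      unfolding T_def N_def V_def
      by (subst Bochner_Integration.integral_sum) (auto intro: inth simp: integral_half_cos_power[OF I(3) d(1) d0])
    ultimately have "(LINT p|?S. \<nu> p + s - 2 * sqrt s * T p) = (2 * s - 2 * sqrt s * (N * cap_moment d k)) * V"
      using intT int\<nu>' by (simp add: V_def algebra_simps)
    also have "\<dots> \<ge> s * V" using le V by (intro mult_right_mono) auto
    finally have "s * V \<le> (LINT p|?S. \<nu> p + s - 2 * sqrt s * T p)" .
    also have "\<dots> \<le> (LINT p|?S. \<bar>\<nu> p - s\<bar>)"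
      using intT int\<nu>' by (intro integral_mono int\<nu>) (auto intro: pt)
    finally show ?thesis .
  qed
  define b where "b = V * n * d * cap_moment d (n - 1)"
  have b0: "b \<ge> 0" using V d0 mu[of "n - 1"] by (simp add: b_def)
  \<comment> \<open>The chain runs through nonnegative integrals, so that Tonelli's theorem
    exchanges the order of integration from joint measurability.\<close>
  have "ennreal (s * V) \<le> ennreal (LINT p|?S. \<bar>\<nu> p - s\<bar>)"
    using lower by (rule ennreal_leI)
  also have "\<dots> = (\<integral>\<^sup>+p. ennreal \<bar>\<nu> p - s\<bar> \<partial>?S)"
    using int\<nu> by (intro nn_integral_eq_integral[symmetric]) auto
  also have "\<dots> \<le> (\<integral>\<^sup>+p. (\<integral>\<^sup>+y. ennreal (\<bar>U y\<bar> * \<bar>\<Lambda> p y\<bar>) \<partial>?S) \<partial>?S)"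
  proof (rule nn_integral_mono)
    fix p assume "p \<in> space ?S"
    then have p: "norm p = 1" by simp
    have "integrable ?S (\<lambda>y. U y * \<Lambda> p y)"
    proof -
      have "U y * \<Lambda> p y = (real n * (real n + d - 1)) * (U y * half_cos p y ^ n)
         - (real n * (real n - 1 + d / 2)) * (U y * half_cos p y ^ (n - 1))" for y
        by (simp add: \<Lambda>_def algebra_simps)
      then show ?thesis using integrable_mult_half_cos_power[OF intU p] by simp
    qed
    then have "ennreal \<bar>LINT y|?S. U y * \<Lambda> p y\<bar> \<le> (\<integral>\<^sup>+y. ennreal (norm (U y * \<Lambda> p y)) \<partial>?S)"
      using integral_norm_bound_ennreal[of ?S "\<lambda>y. U y * \<Lambda> p y"] by simp
    then show "ennreal \<bar>\<nu> p - s\<bar> \<le> (\<integral>\<^sup>+y. ennreal (\<bar>U y\<bar> * \<bar>\<Lambda> p y\<bar>) \<partial>?S)"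
      unfolding \<Lambda>int[OF p] by (simp add: abs_mult)
  qed
  also have "\<dots> = (\<integral>\<^sup>+y. (\<integral>\<^sup>+p. ennreal (\<bar>U y\<bar> * \<bar>\<Lambda> p y\<bar>) \<partial>?S) \<partial>?S)"
  proof (rule pair.Fubini'[symmetric])
    have hm: "(\<lambda>z. half_cos (fst z) (snd z)) \<in> borel_measurable (?S \<Otimes>\<^sub>M ?S)"
      using measurable_half_cos_pair[where 'a='a] by (simp add: case_prod_beta)
    have um: "(\<lambda>z. U (snd z)) \<in> borel_measurable (?S \<Otimes>\<^sub>M ?S)"
      using borel_measurable_integrable[OF intU] by (rule measurable_compose[OF measurable_snd])
    have "(\<lambda>z. ennreal (\<bar>U (snd z)\<bar> * \<bar>\<Lambda> (fst z) (snd z)\<bar>)) \<in> borel_measurable (?S \<Otimes>\<^sub>M ?S)"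
      unfolding \<Lambda>_def using hm um by measurable
    then show "(\<lambda>(p, y). ennreal (\<bar>U y\<bar> * \<bar>\<Lambda> p y\<bar>)) \<in> borel_measurable (?S \<Otimes>\<^sub>M ?S)"
      by (simp add: case_prod_beta)
  qed
  also have "\<dots> \<le> (\<integral>\<^sup>+y. ennreal (\<bar>U y\<bar> * b) \<partial>?S)"
  proof (rule nn_integral_mono)
    fix y assume "y \<in> space ?S"
    then have y: "norm y = 1" by simp
    have int: "integrable ?S (\<lambda>p. \<bar>U y\<bar> * \<bar>\<Lambda> p y\<bar>)"
      unfolding \<Lambda>_def half_cos_commute[of _ y]
      by (intro integrable_abs Bochner_Integration.integrable_diff integrable_mult_right inth)
    have "(\<integral>\<^sup>+p. ennreal (\<bar>U y\<bar> * \<bar>\<Lambda> p y\<bar>) \<partial>?S) = ennreal (LINT p|?S. \<bar>U y\<bar> * \<bar>\<Lambda> p y\<bar>)"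
      using int by (intro nn_integral_eq_integral) auto
    also have "\<dots> \<le> ennreal (\<bar>U y\<bar> * b)"
      using \<Lambda>abs[OF y] by (intro ennreal_leI) (simp add: b_def mult_left_mono)
    finally show "(\<integral>\<^sup>+p. ennreal (\<bar>U y\<bar> * \<bar>\<Lambda> p y\<bar>) \<partial>?S) \<le> ennreal (\<bar>U y\<bar> * b)" .
  qed
  also have "\<dots> = ennreal (LINT y|?S. \<bar>U y\<bar> * b)"
    using intU b0 by (intro nn_integral_eq_integral) auto
  finally have "s * V \<le> (LINT y|?S. \<bar>U y\<bar> * b)"
    using b0 by (subst (asm) ennreal_le_iff) (auto intro!: integral_nonneg_AE)
  also have "\<dots> = (LINT y|?S. \<bar>U y\<bar>) * b" by simp
  also have "\<dots> \<le> (- 2 * m * V) * b" using absU b0 by (rule mult_right_mono)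
  finally have "s * V \<le> (- 2 * m * V) * b" .
  then have "s * V \<le> (- 2 * m * b) * V" by (simp only: mult.assoc mult.commute[of V b])
  then have "s \<le> - 2 * m * b" using V by (simp only: mult_le_cancel_right_pos)
  \<comment> \<open>Consecutive moments have ratio at least \<open>1 / 2\<close>, so
    \<open>s\<close> can be compared with the moment \<open>n - 1\<close> contained in
    \<open>b\<close>, which then cancels.\<close>
  moreover have "s \<ge> N * (cap_moment d (n - 1) / 2)"
  proof -
    obtain j where j: "n = Suc j" using n by (cases n) auto
    have "(real j + d / 2) / (real j + d) \<ge> 1 / 2" using d0 by (simp add: le_divide_eq field_simps)
    then have "cap_moment d j * (1 / 2) \<le> cap_moment d j * ((real j + d / 2) / (real j + d))"
      using mu[of j] by (intro mult_left_mono) auto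
    then have "N * (cap_moment d j * (1 / 2)) \<le> N * (cap_moment d j * ((real j + d / 2) / (real j + d)))"
      by (rule mult_left_mono) (use N in simp)
    then show ?thesis unfolding s_def j cap_moment_Suc by simp
  qed
  ultimately have "N * (cap_moment d (n - 1) / 2) \<le> - 2 * m * b" by linarith
  then have "(N / 2) * cap_moment d (n - 1) \<le> (- 2 * m * (V * n * d)) * cap_moment d (n - 1)"
    by (simp add: b_def mult_ac)
  then have "N / 2 \<le> - 2 * m * (V * n * d)"
    using mu[of "n - 1"] by (simp only: mult_le_cancel_right_pos)
  then have "N \<le> - m * (8 * V * k * d)" by (simp add: n_def)
  moreover have "8 * V * k * d > 0" using V k d0 by simp
  ultimately have "N / (8 * V * k * d) \<le> - m" by (simp only: pos_divide_le_eq)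
  then show ?thesis by (simp add: N_def V_def)
qed

section \<open>Greedy sequences\<close>

lemma finite_not_covers_sphere:
  fixes A :: "'a::euclidean_space set"
  assumes "finite A" and d: "real DIM('a) - 1 \<ge> 2"
  obtains y where "norm y = 1" "y \<notin> A"
proof -
  let ?S = "sphere_vol :: 'a measure"
  have "\<not> unit_sphere \<subseteq> A"
  proof
    assume sub: "unit_sphere \<subseteq> A"
    have "AE y in ?S. y \<notin> A \<inter> unit_sphere"
      by (rule AE_sphere_vol_not_finite) (use assms in auto)
    then have "AE y in ?S. False"
      using AE_space[of ?S] by eventually_elim (use sub in auto)
    then have "emeasure ?S unit_sphere = 0"
      by (simp add: AE_iff_null null_sets_def flip: space_sphere_vol)
    then show False using measure_sphere_vol_pos[where 'a='a] by (simp add: measure_def)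
  qed
  then obtain y where "y \<in> unit_sphere" "y \<notin> A" by blast
  then show ?thesis using that[of y] by simp
qed

text \<open>At an occupied point the potential is infinite, at any other point finite, and finitely
  many points do not cover the sphere. Hence each minimizer is a new point and the comparison of
  potentials takes place in the reals.\<close>

lemma greedy_sequenceD:
  fixes G :: "'a::euclidean_space \<Rightarrow> 'a \<Rightarrow> ereal"
  assumes G: "green_kernel G" and d: "real DIM('a) - 1 \<ge> 2" and x: "greedy_sequence G x"
  shows greedy_norm: "n \<ge> 1 \<Longrightarrow> norm (x n) = 1"
    and greedy_new: "N \<ge> 1 \<Longrightarrow> x (N + 1) \<notin> x ` {1..N}"
    and greedy_min: "N \<ge> 1 \<Longrightarrow> norm y = 1 \<Longrightarrow> y \<notin> x ` {1..N} \<Longrightarrow>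
      (\<Sum>i=1..N. real_of_ereal (G (x i) (x (N + 1)))) \<le> (\<Sum>i=1..N. real_of_ereal (G (x i) y))"
proof -
  have arg: "is_arg_min (\<lambda>y. \<Sum>i\<in>{1..N}. G y (x i)) (\<lambda>y. y \<in> unit_sphere) (x (N + 1))" if "N \<ge> 1" for N
    using x that unfolding greedy_sequence_def by blast
  show norm: "norm (x n) = 1" if "n \<ge> 1" for n
  proof (cases "n = 1")
    case True
    then show ?thesis using x unfolding greedy_sequence_def by simp
  next
    case False
    then show ?thesis using arg[of "n - 1"] that by (simp add: is_arg_min_def)
  qed
  have fin: "(\<Sum>i\<in>{1..N}. G y (x i)) = ereal (\<Sum>i=1..N. real_of_ereal (G (x i) y))"
    if y: "norm y = 1" "y \<notin> x ` {1..N}" for N y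
  proof -
    have "G y (x i) = ereal (real_of_ereal (G (x i) y))" if "i \<in> {1..N}" for i
    proof -
      have "norm (x i) = 1" "x i \<noteq> y" using that norm y by auto
      then show ?thesis
        using green_kernelD(2,3)[OF G, of y "x i"] y by (simp add: ereal_real')
    qed
    then have "(\<Sum>i\<in>{1..N}. G y (x i)) = (\<Sum>i\<in>{1..N}. ereal (real_of_ereal (G (x i) y)))"
      by (intro sum.cong) auto
    then show ?thesis by simp
  qed
  show new: "x (N + 1) \<notin> x ` {1..N}" if N: "N \<ge> 1" for N
  proof
    assume "x (N + 1) \<in> x ` {1..N}"
    then obtain i where i: "i \<in> {1..N}" "x (N + 1) = x i" by auto
    have "G (x (N + 1)) (x i) = \<infinity>"
      unfolding i(2) using green_kernelD(1)[OF G, of "x i"] norm i by simp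
    then have inf: "(\<Sum>i\<in>{1..N}. G (x (N + 1)) (x i)) = \<infinity>"
      using i unfolding sum_Pinfty by auto
    obtain y where y: "norm y = 1" "y \<notin> x ` {1..N}"
      using finite_not_covers_sphere[OF _ d, of "x ` {1..N}"] by auto
    have "(\<Sum>i\<in>{1..N}. G y (x i)) < (\<Sum>i\<in>{1..N}. G (x (N + 1)) (x i))"
      unfolding inf fin[OF y] by simp
    then show False using arg[OF N] y unfolding is_arg_min_def by auto
  qed
  show "(\<Sum>i=1..N. real_of_ereal (G (x i) (x (N + 1)))) \<le> (\<Sum>i=1..N. real_of_ereal (G (x i) y))"
    if N: "N \<ge> 1" and y: "norm y = 1" "y \<notin> x ` {1..N}"
  proof -
    have "\<not> (\<Sum>i\<in>{1..N}. G y (x i)) < (\<Sum>i\<in>{1..N}. G (x (N + 1)) (x i))"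
      using arg[OF N] y unfolding is_arg_min_def by auto
    moreover have xN: "norm (x (N + 1)) = 1" by (rule norm) simp
    ultimately show ?thesis
      unfolding fin[OF y] fin[OF xN new[OF N]] by simp
  qed
qed

lemma greedy_inj_on:
  fixes G :: "'a::euclidean_space \<Rightarrow> 'a \<Rightarrow> ereal"
  assumes G: "green_kernel G" and d: "real DIM('a) - 1 \<ge> 2" and x: "greedy_sequence G x"
  shows "inj_on x {1..N}"
proof (induction N)
  case (Suc N)
  show ?case
  proof (cases "N = 0")
    case False
    then show ?thesis
      using Suc greedy_new[OF G d x, of N] by (simp add: atLeastAtMostSuc_conv)
  qed simp
qed simp

text \<open>From \<open>a \<le> 1\<close> follows \<open>j powr a \<ge> N powr (a - 1) * j\<close>
  for \<open>j\<close> below \<open>N\<close>, which reduces the sum to an arithmetic progression;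
  \<open>N \<ge> 2\<close> gives \<open>N - 1 \<ge> N / 2\<close>.\<close>

lemma sum_powr_ge:
  fixes a :: real
  assumes a: "a \<le> 1" and N: "N \<ge> 2"
  shows "(\<Sum>j=1..<N. real j powr a) \<ge> real N powr (1 + a) / 4"
proof -
  have "real N powr (a - 1) * j \<le> real j powr a" if j: "j \<in> {1..<N}" for j
  proof -
    have "real N powr (a - 1) \<le> real j powr (a - 1)"
      using j a by (intro powr_mono2') auto
    then have "real N powr (a - 1) * j \<le> real j powr (a - 1) * j" by (intro mult_right_mono) auto
    also have "\<dots> = real j powr a" using j by (simp add: powr_diff)
    finally show ?thesis .
  qed
  then have "(\<Sum>j=1..<N. real N powr (a - 1) * j) \<le> (\<Sum>j=1..<N. real j powr a)" by (rule sum_mono)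
  moreover have "(\<Sum>j=1..<N. real N powr (a - 1) * j) = real N powr (a - 1) * (real N * (real N - 1) / 2)"
  proof -
    have "(\<Sum>j=1..<M. real j) = real M * (real M - 1) / 2" if "M \<ge> 1" for M
      using that by (induction M rule: dec_induct) (auto simp: field_simps)
    from this[of N] show ?thesis using N by (simp add: sum_distrib_left[symmetric])
  qed
  moreover have "real N powr (a - 1) * (real N * (real N - 1) / 2) \<ge> real N powr (a - 1) * (real N * (real N / 2) / 2)"
    using N by (intro mult_left_mono divide_right_mono) auto
  moreover have "real N powr (a - 1) * (real N * (real N / 2) / 2) = real N powr (1 + a) / 4"
  proof -
    have "real N powr (1 + a) = real N powr ((a - 1) + 1 + 1)" by (simp add: algebra_simps)
    also have "\<dots> = real N powr (a - 1) * real N * real N" using N by (simp only: powr_add) simp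
    finally show ?thesis by simp
  qed
  ultimately show ?thesis by linarith
qed

section \<open>The two energy estimates with explicit constants\<close>

theorem theorem1p9:
  fixes d :: nat
    and G :: "'a::euclidean_space \<Rightarrow> 'a \<Rightarrow> ereal"
  assumes "d \<ge> 3"
    and "DIM('a) = d + 1"
    and "green_kernel G"
  shows "\<exists>C1 C2 :: real. C1 > 0 \<and> C2 > 0 \<and>
           (\<forall>x. greedy_sequence G x \<longrightarrow>
             (\<forall>N\<ge>2.
                ereal (- C1 * real N powr (2 - 2 / real d)) \<le> energy G x N \<and>
                energy G x N \<le> ereal (- C2 * real N powr (2 - 2 / real d))))"
proof -
  note G = assms(3)
  define V where "V = measure sphere_vol (unit_sphere :: 'a set)"
  have V: "V > 0" unfolding V_def by (rule measure_sphere_vol_pos)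
  have d: "real d = real DIM('a) - 1" "real d \<ge> 3" "real d \<ge> 2" "real DIM('a) - 1 \<ge> 2" "d > 0"
    using assms(1,2) by auto
  have powd: "(c powr (2 / real d)) powr (real d / 2) = c" if "c > 0" for c :: real
  proof -
    have "2 / real d * (real d / 2) = 1" using d(5) by simp
    then show ?thesis using that by (simp only: powr_powr powr_one)
  qed
  have pow_split: "real N powr (2 - 2 / real d) = (real N)\<^sup>2 / real N powr (2 / real d)" if "N \<ge> 1" for N :: nat
    using that by (simp add: powr_diff)
  \<comment> \<open>The factor \<open>1 / (8 * V * k * d)\<close> of the potential bound, with
    \<open>k\<close> replaced by \<open>4 * (3 * (real d)\<^sup>2 + 1)\<close>; the power of the
    number of points is split off. The final \<open>c / 2\<close> is \<open>2 * c\<close> per greedy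
    step times the \<open>1 / 4\<close> of \<open>sum_powr_ge\<close>.\<close>
  define c where "c = 1 / (32 * V * d * (3 * (real d)\<^sup>2 + 1))"
  \<comment> \<open>The summand with \<open>3 powr (real d / 2)\<close> pays for the diagonal, the
    \<open>1\<close> for the truncation.\<close>
  define C1 where "C1 = (4 * 3 powr (real d / 2) + 1) / V"
  have c: "c > 0" using V d by (simp add: c_def add_pos_pos)
  have C1: "C1 > 0" using V by (simp add: C1_def add_nonneg_pos)
  have "ereal (- C1 * real N powr (2 - 2 / real d)) \<le> energy G x N \<and>
      energy G x N \<le> ereal (- (c / 2) * real N powr (2 - 2 / real d))"
    if x: "greedy_sequence G x" and N: "N \<ge> 2" for x N
  proof -
    let ?g = "\<lambda>x y. real_of_ereal (G x y)"
    note norm = greedy_norm[OF G d(4) x] and inj = greedy_inj_on[OF G d(4) x]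
    define E where "E = (\<lambda>N. \<Sum>i\<in>{1..N}. \<Sum>j\<in>{1..N} - {i}. ?g (x i) (x j))"
    have energy: "energy G x N = ereal (E N)" for N
    proof -
      have "G (x i) (x j) = ereal (?g (x i) (x j))" if "i \<in> {1..N}" "j \<in> {1..N} - {i}" for i j
      proof -
        have "x i \<noteq> x j" using that inj[of N] by (auto dest: inj_onD)
        then show ?thesis using green_kernelD(3)[OF G norm[of i] norm[of j]] that by (simp add: ereal_real')
      qed
      then have "energy G x N = (\<Sum>i\<in>{1..N}. \<Sum>j\<in>{1..N} - {i}. ereal (?g (x i) (x j)))"
        unfolding energy_def by (intro sum.cong refl)
      then show ?thesis by (simp add: E_def)
    qed
    have "- C1 * real N powr (2 - 2 / real d) \<le> E N"
    proof -
      define r where "r = real N powr (2 / real d)"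
      \<comment> \<open>With this \<open>m\<close> the diagonal and the truncation error are both of
        order \<open>N\<^sup>2 / r\<close>.\<close>
      define m where "m = nat \<lceil>r\<rceil>"
      have r: "r \<ge> 1" unfolding r_def using N by (intro ge_one_powr_ge_zero) auto
      have m: "real m \<ge> r" "real m \<le> r + 1" "m \<ge> 1" using r unfolding m_def by linarith+
      have "1 / cap_moment (real d) m \<le> (real m + 1) powr (real d / 2)"
        by (rule inverse_cap_moment_le[OF d(3)])
      also have "\<dots> \<le> (3 * r) powr (real d / 2)" using m r by (intro powr_mono2) auto
      also have "\<dots> = 3 powr (real d / 2) * N" using N r by (simp add: powr_mult r_def powd)
      finally have mu: "1 / cap_moment (real d) m \<le> 3 powr (real d / 2) * N" .
      have "4 / ((real m + 2) * cap_moment (real d) m) = 4 / (real m + 2) * (1 / cap_moment (real d) m)" by simp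
      also have "\<dots> \<le> 4 / r * (3 powr (real d / 2) * N)"
        using mu m r cap_moment_pos[of "real d" m] d by (intro mult_mono divide_left_mono) auto
      finally have "N * (4 / ((real m + 2) * cap_moment (real d) m)) \<le> N * (4 / r * (3 powr (real d / 2) * N))"
        by (intro mult_left_mono) auto
      moreover have "(real N)\<^sup>2 / m \<le> (real N)\<^sup>2 / r"
        using m r by (intro divide_left_mono) auto
      moreover have "- (N * (4 / ((real m + 2) * cap_moment (real d) m)) + (real N)\<^sup>2 / m) \<le> V * E N"
        using green_energy_ge[OF G d(1,2), of "{1..N}" x m] inj norm m(3) by (simp add: E_def V_def)
      ultimately have "- (N * (4 / r * (3 powr (real d / 2) * N)) + (real N)\<^sup>2 / r) \<le> V * E N" by linarith
      also have "N * (4 / r * (3 powr (real d / 2) * N)) + (real N)\<^sup>2 / r = (4 * 3 powr (real d / 2) + 1) * ((real N)\<^sup>2 / r)"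
        by (simp add: power2_eq_square add_divide_distrib distrib_right)
      also have "(real N)\<^sup>2 / r = real N powr (2 - 2 / real d)"
        using pow_split[of N] N by (simp add: r_def)
      finally show ?thesis using V by (simp add: C1_def field_simps)
    qed
    moreover have "E N \<le> - (c / 2) * real N powr (2 - 2 / real d)"
    proof -
      define U where "U = (\<lambda>N. \<Sum>i=1..N. ?g (x i) (x (N + 1)))"
      \<comment> \<open>By symmetry the new point enters the ordered pairs twice, once in each
        argument.\<close>
      have E_Suc: "E (Suc N) = E N + 2 * U N" for N
      proof -
        have "E (Suc N) = (\<Sum>i\<in>{1..N}. \<Sum>j\<in>{1..Suc N} - {i}. ?g (x i) (x j)) + (\<Sum>j\<in>{1..N}. ?g (x (Suc N)) (x j))"
        proof -
          have "{1..Suc N} - {Suc N} = {1..N}" by auto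
          then show ?thesis unfolding E_def by simp
        qed
        also have "(\<Sum>i\<in>{1..N}. \<Sum>j\<in>{1..Suc N} - {i}. ?g (x i) (x j)) 
          = (\<Sum>i\<in>{1..N}. (\<Sum>j\<in>{1..N} - {i}. ?g (x i) (x j)) + ?g (x i) (x (Suc N)))"
        proof (intro sum.cong refl)
          fix i assume "i \<in> {1..N}"
          then have "{1..Suc N} - {i} = insert (Suc N) ({1..N} - {i})" by auto
          then show "(\<Sum>j\<in>{1..Suc N} - {i}. ?g (x i) (x j)) = (\<Sum>j\<in>{1..N} - {i}. ?g (x i) (x j)) + ?g (x i) (x (Suc N))"
            by simp
        qed
        also have "(\<Sum>j\<in>{1..N}. ?g (x (Suc N)) (x j)) = U N"
          unfolding U_def using green_kernelD(2)[OF G norm norm] by (intro sum.cong) auto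
        finally show ?thesis by (simp add: sum.distrib E_def U_def)
      qed
      have U: "U M \<le> - c * real M powr (1 - 2 / real d)" if M: "M \<ge> 1" for M
      proof -
        define r where "r = real M powr (2 / real d)"
        \<comment> \<open>The least integer that meets the threshold of
          \<open>cap_moment_square_bound\<close> for \<open>M\<close> points.\<close>
        define k where "k = nat \<lceil>3 * (real d)\<^sup>2 * (4 * real M) powr (2 / real d)\<rceil>"
        have r: "r \<ge> 1" unfolding r_def using M by (intro ge_one_powr_ge_zero) auto
        have "(4 * real M) powr (2 / real d) = 4 powr (2 / real d) * r"
          by (simp add: r_def powr_mult)
        moreover have "4 powr (2 / real d) \<le> (4::real) powr 1" using d by (intro powr_mono) auto
        ultimately have "(4 * real M) powr (2 / real d) \<le> 4 * r"
          using r by (simp add: mult_right_mono)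
        then have "3 * (real d)\<^sup>2 * (4 * real M) powr (2 / real d) \<le> 3 * (real d)\<^sup>2 * (4 * r)"
          by (intro mult_left_mono) auto
        moreover have pos: "3 * (real d)\<^sup>2 * (4 * real M) powr (2 / real d) > 0"
          using d M by simp
        \<comment> \<open>Rounding up adds at most \<open>1 \<le> 4 * r\<close>; this slack lets the
          bound factor as \<open>4 * (3 * (real d)\<^sup>2 + 1) * r\<close>.\<close>
        ultimately have k: "real k \<ge> 3 * (real d)\<^sup>2 * (4 * real M) powr (2 / real d)" "k \<ge> 1"
          "real k \<le> 3 * (real d)\<^sup>2 * (4 * r) + 4 * r"
          unfolding k_def using r by linarith+
        have kr: "real k \<le> 4 * (3 * (real d)\<^sup>2 + 1) * r" using k(3) by (simp add: algebra_simps)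
        have "U M \<le> - (M / (8 * V * k * d))"
          unfolding V_def
        proof (rule order_trans[OF green_potential_min_le[OF G d(1,3), of "{1..M}" x k]])
          show "4 * real (card {1..M}) * (cap_moment (real d) k)\<^sup>2 \<le> cap_moment (real d) (2 * k)"
            using cap_moment_square_bound[OF d(3), of "real M" k] M k by simp
          show "U M \<le> (\<Sum>i\<in>{1..M}. ?g (x i) y)" if "norm y = 1" "y \<notin> x ` {1..M}" for y
            unfolding U_def by (rule greedy_min[OF G d(4) x M that])
        qed (use M norm k in auto)
        also have "- (M / (8 * V * k * d)) \<le> - (M / (8 * V * (4 * (3 * (real d)\<^sup>2 + 1) * r) * d))"
          using kr k V \<open>d > 0\<close> r
          by (intro le_imp_neg_le divide_left_mono mult_right_mono mult_left_mono mult_pos_pos) (auto intro: add_nonneg_pos)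
        also have "M / (8 * V * (4 * (3 * (real d)\<^sup>2 + 1) * r) * d) = c * (M / r)"
          by (simp add: c_def mult_ac)
        also have "M / r = real M powr (1 - 2 / real d)"
          using M by (simp add: r_def powr_diff)
        finally show ?thesis by simp
      qed
      \<comment> \<open>One point has energy \<open>0\<close>, matching the empty sum at
        \<open>M = 1\<close>; the step to \<open>Suc M\<close> uses the potential of the first
        \<open>M\<close> points.\<close>
      have "E M \<le> - 2 * c * (\<Sum>j=1..<M. real j powr (1 - 2 / real d))" if "M \<ge> 1" for M
        using that
      proof (induction M rule: dec_induct)
        case base
        show ?case by (simp add: E_def)
      next
        case (step M)
        then show ?case using U[of M]
          by (simp add: E_Suc algebra_simps)
      qed
      then have "E N \<le> - 2 * c * (\<Sum>j=1..<N. real j powr (1 - 2 / real d))" using N by simp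
      also have "\<dots> \<le> - 2 * c * (real N powr (1 + (1 - 2 / real d)) / 4)"
        using c sum_powr_ge[of "1 - 2 / real d" N] N by (intro mult_left_mono_neg) auto
      finally show ?thesis by simp
    qed
    ultimately show ?thesis by (simp add: energy)
  qed
  then show ?thesis using C1 c by (intro exI[of _ C1] exI[of _ "c / 2"]) auto
qed

end
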